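(* Let $d,n\in\mathbb{N}$ and $k$ vary with $n\to\infty$ so that $1\ll k\lesssim\log n$ and $k-d\asymp k$. Then, with implicit constants uniform over all Abelian groups $G$ with $|G|=n$ and $d(G)=d$, $$\max_{L\in\mathbb{N}} t_0\bigl(L,|G/LG|\bigr)\asymp k\,|G|^{2/k}.$$
   Context: Asymptotic notation: $a\ll b$ means $a/b\to0$; $a\lesssim b$ means $a\le Cb$ for a constant $C$; $a\asymp b$ means $a\lesssim b$ and $b\lesssim a$. For a finite Abelian group $G$ (written additively), $d(G)$ is the minimal size of a generating subset of $G$ and $LG:=\{Lx: x\in G\}$. The walk is either the rate-1 simple random walk (jumps $\pm1$ mod $L$ with probability $1/2$ each) or the rate-1 directed random walk (jumps $+1$ mod $L$) on $\mathbb{Z}_L$, started at $0$. $H_L(s)$ is the Shannon entropy (natural logarithm) of its position at time $s$; for $L\ge2$, $H_L$ is a strictly increasing bijection from $[0,\infty)$ to $[0,\log L)$. For $L,N\in\mathbb{N}$ the entropic time (with $k$ coordinates) is $$t_0(L,N):=k\,H_L^{-1}\bigl((\log N)/k\bigr).$$ The trivial case $L=1$ (where $H_1\equiv0$ and $|G/LG|=1$) is given the value $0$. The statement holds for both walks. *)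

theory Defs
  imports
    "HOL-Probability.Probability"
    "HOL-Library.Landau_Symbols"
    "HOL-Algebra.Generated_Groups"
begin

datatype walk = Simple | Directed

fun jump_pmf :: "walk \<Rightarrow> int pmf" where
  "jump_pmf Simple = pmf_of_set {-1, 1}"
| "jump_pmf Directed = return_pmf 1"

text \<open>\<open>\<int>\<^sub>L\<close> is represented by the residues \<open>{0..<L}\<close>.\<close>

fun jump_chain_pmf :: "walk \<Rightarrow> nat \<Rightarrow> nat \<Rightarrow> int pmf" where
  "jump_chain_pmf w L 0 = return_pmf 0"
| "jump_chain_pmf w L (Suc m) =
    bind_pmf (jump_chain_pmf w L m) (\<lambda>x. map_pmf (\<lambda>\<xi>. (x + \<xi>) mod int L) (jump_pmf w))"

text \<open>The rate of \<^const>\<open>poisson_pmf\<close> has to be positive, whence the case distinction.\<close>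

definition jump_count_pmf :: "real \<Rightarrow> nat pmf" where
  "jump_count_pmf s = (if s = 0 then return_pmf 0 else poisson_pmf s)"

definition walk_pmf :: "walk \<Rightarrow> nat \<Rightarrow> real \<Rightarrow> int pmf" where
  "walk_pmf w L s = bind_pmf (jump_count_pmf s) (jump_chain_pmf w L)"

definition walk_entropy :: "walk \<Rightarrow> nat \<Rightarrow> real \<Rightarrow> real" where
  "walk_entropy w L s =
    prob_space.entropy (measure_pmf (walk_pmf w L s)) (exp 1) (count_space UNIV) (\<lambda>x. x)"

text \<open>
  For \<open>L \<ge> 2\<close>, \<open>walk_entropy w L\<close> is a strictly increasing bijection from
  \<open>{0..}\<close> to \<open>{0..<ln L}\<close>, and \<open>entropic_time\<close> is only meaningful for \<open>N < L ^ k\<close>.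
\<close>

definition entropic_time :: "walk \<Rightarrow> nat \<Rightarrow> nat \<Rightarrow> nat \<Rightarrow> real" where
  "entropic_time w k L N =
    (if L = 1 then 0
     else real k * inv_into {0..} (walk_entropy w L) (ln (real N) / real k))"

definition min_generators :: "('a, 'b) monoid_scheme \<Rightarrow> nat" where
  "min_generators G =
    (LEAST m. \<exists>S \<subseteq> carrier G. finite S \<and> card S = m \<and> generate G S = carrier G)"

text \<open>The subgroup \<open>LG\<close>, in the multiplicative notation of the library.\<close>

definition multiples :: "nat \<Rightarrow> ('a, 'b) monoid_scheme \<Rightarrow> 'a set" where
  "multiples L G = {x [^]\<^bsub>G\<^esub> L | x. x \<in> carrier G}"

lemma set_pmf_jump_chain: "L > 0 \<Longrightarrow> set_pmf (jump_chain_pmf w L m) \<subseteq> {0..<int L}"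
  by (induction m) auto

lemma set_pmf_walk: "L > 0 \<Longrightarrow> set_pmf (walk_pmf w L s) \<subseteq> {0..<int L}"
  unfolding walk_pmf_def set_bind_pmf by (intro UN_least set_pmf_jump_chain)

lemma walk_entropy_eq_sum:
  assumes "L > 0"
  shows "walk_entropy w L s =
    - (\<Sum>x\<in>{0..<int L}. pmf (walk_pmf w L s) x * ln (pmf (walk_pmf w L s) x))"
proof -
  define p where "p = walk_pmf w L s"
  have "pmf p x = 0" if "x \<notin> {0..<int L}" for x
    using set_pmf_walk[OF assms, of w s] that unfolding p_def pmf_eq_0_set_pmf by blast
  hence support: "{x. pmf p x * log (exp 1) (pmf p x) \<noteq> 0} \<subseteq> {0..<int L}"
    by fastforce
  interpret information_space "measure_pmf p" "exp 1"
    by unfold_locales simp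
  have "distr (measure_pmf p) (count_space UNIV) (\<lambda>x. x) = measure_pmf p"
    by (rule measure_eqI) (simp_all add: emeasure_distr)
  hence "distributed (measure_pmf p) (count_space UNIV) (\<lambda>x. x) (\<lambda>x. ennreal (pmf p x))"
    unfolding distributed_def by (simp add: measure_pmf_eq_density[symmetric])
  hence "prob_space.entropy (measure_pmf p) (exp 1) (count_space UNIV) (\<lambda>x. x)
      = - (\<integral>x. pmf p x * log (exp 1) (pmf p x) \<partial>count_space UNIV)"
    by (intro entropy_distr) simp_all
  also have "(\<integral>x. pmf p x * log (exp 1) (pmf p x) \<partial>count_space UNIV)
      = (\<Sum>x\<in>{x. pmf p x * log (exp 1) (pmf p x) \<noteq> 0}. pmf p x * log (exp 1) (pmf p x))"
    using lebesgue_integral_count_space_finite_support[of UNIV "\<lambda>x. pmf p x * log (exp 1) (pmf p x)"]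
      finite_subset[OF support] by simp
  also have "\<dots> = (\<Sum>x\<in>{0..<int L}. pmf p x * log (exp 1) (pmf p x))"
    by (rule sum.mono_neutral_left) (use support in auto)
  finally show ?thesis
    by (simp add: walk_entropy_def p_def log_def)
qed

end

theory Submission
  imports
    Defs
    "HOL-Algebra.Multiplicative_Group"
    "HOL-Real_Asymp.Real_Asymp"
begin

text \<open>
  Fix \<open>L \<ge> 2\<close> and let \<open>s\<close> be the time at which the walk on the cycle of length \<open>L\<close> has entropy
  \<open>h = ln N / k\<close>, where \<open>N\<close> is the order of the quotient of \<open>G\<close> by its \<open>L\<close>-th multiples. As long
  as the walk has not wrapped around the cycle, it is spread over about \<open>sqrt s\<close> points, so
  its entropy is about \<open>ln (sqrt s)\<close> and \<open>s\<close> is of order \<open>exp (2 h)\<close>, that is,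
  \<open>N powr (2 / k)\<close>. This is at most \<open>n powr (2 / k)\<close> because \<open>N \<le> n\<close>, with equality for
  \<open>L = n\<close>, where the subgroup of multiples is trivial.

  The upper bound has to exclude that the walk is already almost uniform on the cycle, because then
  the time would no longer be controlled by the entropy. The quotient is generated by \<open>d\<close> elements
  and has exponent dividing \<open>L\<close>, so \<open>N \<le> L ^ d\<close>, and \<open>d \<le> (1 - \<delta>) k\<close> keeps \<open>h\<close> at a
  distance of at least \<open>\<delta> ln L\<close> below the maximal entropy \<open>ln L\<close>. Fourier analysis on the
  cycle bounds the law by \<open>1 / L + 2 / sqrt s\<close> (\<open>pmf_walk_le\<close>); the gap forces the second term
  to make up a fixed fraction of \<open>exp (- h)\<close>, and \<open>entropic_time_le\<close> follows.

  The lower bound needs an upper bound on the entropy that is uniform in the length of the cycle.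
  It comes from Gibbs' inequality with heavy-tailed reference weights and the second moment of the
  walk on the integers (\<open>walk_entropy_le\<close>). When \<open>k\<close> is of order \<open>ln n\<close>, the level \<open>h\<close> may stay
  bounded; it is then also bounded away from \<open>0\<close>, so \<open>s\<close> is too, and
  \<open>entropic_time_ge\<close> covers this range with a smaller constant.

  The maximum over all \<open>L\<close> exists because \<open>L\<close> may be replaced by its greatest common divisor with
  \<open>n\<close>: the quotient does not change, and on a shorter cycle that divides the original one the same
  entropy is reached later (\<open>entropic_time_gcd_order\<close>). This comparison of times uses that the
  entropy increases strictly in time (\<open>walk_entropy_less\<close>) and does not increase under projection
  (\<open>walk_entropy_dvd_le\<close>).
\<close>

section \<open>The law of the walk\<close>

lemma finite_set_pmf_jump_chain: "finite (set_pmf (jump_chain_pmf w L m))"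
proof (induction m)
  case (Suc m)
  have "finite (set_pmf (jump_pmf w))"
    by (cases w) simp_all
  with Suc show ?case by simp
qed simp

lemma pmf_jump_count:
  assumes "s \<ge> 0"
  shows "pmf (jump_count_pmf s) m = s ^ m / fact m * exp (- s)"
proof (cases "s = 0")
  case True
  then show ?thesis by (cases m) (simp_all add: jump_count_pmf_def pmf_return)
next
  case False
  with assms show ?thesis by (simp add: jump_count_pmf_def)
qed

lemma sums_integral_pmf_nat:
  fixes f :: "nat \<Rightarrow> real" and M :: "nat pmf"
  assumes "integrable M f"
  shows "(\<lambda>m. pmf M m * f m) sums (\<integral>m. f m \<partial>M)"
proof -
  have "integrable (count_space UNIV) (\<lambda>m. pmf M m *\<^sub>R f m)"
    using assms unfolding measure_pmf_eq_density[of M]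
    by (subst (asm) integrable_density) (auto simp: AE_count_space)
  from sums_integral_count_space_nat[OF this] show ?thesis
    using integral_density[of f "count_space UNIV" "pmf M"]
    by (simp add: measure_pmf_eq_density[symmetric])
qed

lemma pmf_walk_sums:
  assumes "s \<ge> 0"
  shows "(\<lambda>m. s ^ m / fact m * exp (- s) * pmf (jump_chain_pmf w L m) x) sums pmf (walk_pmf w L s) x"
proof -
  have "integrable (jump_count_pmf s) (\<lambda>m. pmf (jump_chain_pmf w L m) x)"
    by (rule measure_pmf.integrable_const_bound[where B = 1]) (auto simp: pmf_le_1)
  from sums_integral_pmf_nat[OF this] show ?thesis
    by (simp add: walk_pmf_def pmf_bind pmf_jump_count[OF assms])
qed

text \<open>
  Conditioning on the Poisson number of jumps. The sum on the right is finite because the walk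
  lives on \<open>{0..<int L}\<close>, so the characteristic function and the moment bound
  below can both be read off term by term from the jump chain.
\<close>

lemma walk_expectation_sums:
  fixes f :: "int \<Rightarrow> 'b :: {banach, second_countable_topology}"
  assumes "s \<ge> 0" "L > 0"
  shows "(\<lambda>m. (s ^ m / fact m * exp (- s)) *\<^sub>R (\<integral>x. f x \<partial>jump_chain_pmf w L m))
    sums (\<Sum>x\<in>{0..<int L}. pmf (walk_pmf w L s) x *\<^sub>R f x)"
proof -
  have "(\<integral>x. f x \<partial>jump_chain_pmf w L m) = (\<Sum>x\<in>{0..<int L}. pmf (jump_chain_pmf w L m) x *\<^sub>R f x)" for m
    using set_pmf_jump_chain[OF assms(2), of w m] by (intro integral_measure_pmf) auto
  moreover have "(\<lambda>m. \<Sum>x\<in>{0..<int L}. (s ^ m / fact m * exp (- s) * pmf (jump_chain_pmf w L m) x) *\<^sub>R f x)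
    sums (\<Sum>x\<in>{0..<int L}. pmf (walk_pmf w L s) x *\<^sub>R f x)"
    using pmf_walk_sums[OF assms(1)]
    by (intro sums_sum bounded_linear.sums[OF bounded_linear_scaleR_left])
  ultimately show ?thesis
    by (simp add: scaleR_sum_right)
qed

text \<open>
  Since \<open>x mod 0 = x\<close> and every \<open>L\<close> divides \<open>0\<close>, the case \<open>L = 0\<close> is the walk on the
  integers, and its projection to each finite cycle is an instance of this lemma.
\<close>

lemma jump_chain_pmf_mod:
  assumes "L' dvd L"
  shows "jump_chain_pmf w L' m = map_pmf (\<lambda>x. x mod int L') (jump_chain_pmf w L m)"
proof (induction m)
  case (Suc m)
  have *: "(x mod int L' + \<xi>) mod int L' = (x + \<xi>) mod int L mod int L'" for x \<xi>
    using assms by (simp add: mod_mod_cancel mod_simps)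
  show ?case
    unfolding jump_chain_pmf.simps Suc
    by (simp add: map_bind_pmf bind_map_pmf map_pmf_comp o_def *)
qed simp

lemma walk_pmf_mod:
  assumes "L' dvd L"
  shows "walk_pmf w L' s = map_pmf (\<lambda>x. x mod int L') (walk_pmf w L s)"
  unfolding walk_pmf_def map_bind_pmf jump_chain_pmf_mod[OF assms, symmetric] ..

lemma sum_pmf_walk:
  assumes "L > 0"
  shows "(\<Sum>x\<in>{0..<int L}. pmf (walk_pmf w L s) x) = 1"
  using set_pmf_walk[OF assms] by (intro sum_pmf_eq_1) auto

section \<open>Characteristic functions on the cycle\<close>

definition residue_char :: "nat \<Rightarrow> nat \<Rightarrow> int \<Rightarrow> complex" where
  "residue_char L j x = cis (2 * pi * real j * real_of_int x / real L)"

lemma residue_char_add: "residue_char L j (x + y) = residue_char L j x * residue_char L j y"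
  by (simp add: residue_char_def cis_mult ring_distribs add_divide_distrib)

lemma residue_char_0 [simp]: "residue_char L j 0 = 1"
  by (simp add: residue_char_def)

lemma norm_residue_char [simp]: "norm (residue_char L j x) = 1"
  by (simp add: residue_char_def)

lemma residue_char_mult_L:
  assumes "L > 0"
  shows "residue_char L j (int L * q) = 1"
proof -
  have "2 * pi * real j * real_of_int (int L * q) / real L = 2 * pi * real_of_int (int j * q)"
    using assms by simp
  then show ?thesis
    unfolding residue_char_def by (metis Ints_of_int cis_multiple_2pi)
qed

lemma residue_char_mod:
  assumes "L > 0"
  shows "residue_char L j (x mod int L) = residue_char L j x"
proof -
  have "residue_char L j x = residue_char L j (int L * (x div int L) + x mod int L)"
    by simp
  also have "\<dots> = residue_char L j (x mod int L)"
    by (simp only: residue_char_add residue_char_mult_L[OF assms] mult_1)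
  finally show ?thesis ..
qed

lemma residue_char_power: "residue_char L j x = residue_char L 1 x ^ j"
  by (simp add: residue_char_def Complex.DeMoivre mult_ac)

text \<open>
  Orthogonality of characters: off the multiples of \<open>L\<close> this is a geometric sum over a
  nontrivial \<open>L\<close>-th root of unity.
\<close>

lemma residue_char_sum:
  assumes "L > 0"
  shows "(\<Sum>j<L. residue_char L j x) = (if int L dvd x then of_nat L else 0)"
proof (cases "int L dvd x")
  case True
  then show ?thesis
    using assms by (auto simp: residue_char_mult_L elim!: dvdE)
next
  case False
  have "residue_char L 1 x \<noteq> 1"
  proof
    assume "residue_char L 1 x = 1"
    then have "cos (2 * pi * real_of_int x / real L) = 1"
      by (simp add: residue_char_def complex_eq_iff)
    then obtain q :: int where "2 * pi * real_of_int x / real L = q * 2 * pi"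
      by (auto simp: cos_one_2pi_int)
    then have "real_of_int x = real_of_int (q * int L)"
      using assms by (simp add: field_simps)
    then have "x = q * int L"
      by (simp only: of_int_eq_iff)
    with False show False by simp
  qed
  moreover have "residue_char L 1 x ^ L = 1"
    using residue_char_mult_L[OF assms, of 1 x]
    by (simp add: residue_char_def Complex.DeMoivre mult_ac)
  ultimately have "(\<Sum>j<L. residue_char L 1 x ^ j) = 0"
    by (simp add: geometric_sum)
  then show ?thesis
    using False by (simp only: residue_char_power[symmetric] if_False)
qed

text \<open>
  The characteristic function of one jump. Its real part is the same cosine for both walks, and
  only the real part enters the modulus of the characteristic function of the walk; this is why
  the two walks can be treated together.
\<close>

definition jump_char :: "walk \<Rightarrow> nat \<Rightarrow> nat \<Rightarrow> complex" where
  "jump_char w L j = (\<integral>\<xi>. residue_char L j \<xi> \<partial>jump_pmf w)"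

lemma Re_jump_char: "Re (jump_char w L j) = cos (2 * pi * real j / real L)"
proof (cases w)
  case Simple
  have "(\<integral>\<xi>. residue_char L j \<xi> \<partial>pmf_of_set {- 1, 1}) = (residue_char L j (-1) + residue_char L j 1) / 2"
    by (subst integral_measure_pmf[where A = "{-1, 1}"]) (auto simp: scaleR_conv_of_real)
  then have "jump_char w L j = (residue_char L j (-1) + residue_char L j 1) / 2"
    by (simp add: Simple jump_char_def)
  then have "Re (jump_char w L j) = Re ((residue_char L j (-1) + residue_char L j 1) / 2)"
    by (rule arg_cong)
  then show ?thesis
    by (simp add: residue_char_def)
next
  case Directed
  then show ?thesis
    by (simp add: jump_char_def residue_char_def)
qed

lemma jump_chain_char:
  assumes "L > 0"
  shows "(\<integral>x. residue_char L j x \<partial>jump_chain_pmf w L m) = jump_char w L j ^ m"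
proof (induction m)
  case (Suc m)
  have fin: "finite (set_pmf (jump_pmf w))"
    by (cases w) simp_all
  have "(\<integral>x. residue_char L j x \<partial>jump_chain_pmf w L (Suc m)) =
    (\<Sum>x\<in>set_pmf (jump_chain_pmf w L m). pmf (jump_chain_pmf w L m) x *\<^sub>R
      (\<integral>y. residue_char L j y \<partial>map_pmf (\<lambda>\<xi>. (x + \<xi>) mod int L) (jump_pmf w)))"
    unfolding jump_chain_pmf.simps
    by (rule pmf_expectation_bind) (use fin in \<open>auto simp: finite_set_pmf_jump_chain\<close>)
  also have "\<dots> = (\<Sum>x\<in>set_pmf (jump_chain_pmf w L m). pmf (jump_chain_pmf w L m) x *\<^sub>R
      residue_char L j x) * jump_char w L j"
    by (simp add: residue_char_mod[OF assms] residue_char_add jump_char_def sum_distrib_right)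
  also have "(\<Sum>x\<in>set_pmf (jump_chain_pmf w L m). pmf (jump_chain_pmf w L m) x *\<^sub>R
      residue_char L j x) = jump_char w L j ^ m"
    unfolding Suc[symmetric]
    by (rule integral_measure_pmf[symmetric]) (auto simp: finite_set_pmf_jump_chain)
  finally show ?case by simp
qed simp

text \<open>
  A compound Poisson sum: \<open>m\<close> jumps contribute the \<open>m\<close>-th power, and averaging powers over
  a Poisson variable gives an exponential.
\<close>

lemma walk_char:
  assumes "L > 0" "s \<ge> 0"
  shows "(\<Sum>x\<in>{0..<int L}. of_real (pmf (walk_pmf w L s) x) * residue_char L j x)
    = exp (of_real s * (jump_char w L j - 1))"
proof -
  have "(\<lambda>m. (s ^ m / fact m * exp (- s)) *\<^sub>R jump_char w L j ^ m)
    sums (\<Sum>x\<in>{0..<int L}. pmf (walk_pmf w L s) x *\<^sub>R residue_char L j x)"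
    using walk_expectation_sums[OF assms(2,1), where f = "residue_char L j" and w = w]
    by (simp add: jump_chain_char[OF assms(1)])
  moreover have "(\<lambda>m. (s ^ m / fact m * exp (- s)) *\<^sub>R jump_char w L j ^ m)
    sums (exp (of_real s * jump_char w L j) * of_real (exp (- s)))"
    using sums_mult2[OF exp_converges[of "of_real s * jump_char w L j"], of "of_real (exp (- s))"]
    by (simp add: scaleR_conv_of_real power_mult_distrib divide_inverse mult_ac)
  ultimately have "(\<Sum>x\<in>{0..<int L}. pmf (walk_pmf w L s) x *\<^sub>R residue_char L j x)
    = exp (of_real s * jump_char w L j) * of_real (exp (- s))"
    by (rule sums_unique2)
  also have "\<dots> = exp (of_real s * (jump_char w L j - 1))"
    by (simp only: exp_of_real[symmetric] exp_add[symmetric]) (simp add: right_diff_distrib)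
  finally show ?thesis
    by (simp add: scaleR_conv_of_real)
qed

lemma walk_inversion:
  assumes "L > 0" "s \<ge> 0" "x \<in> {0..<int L}"
  shows "of_real (pmf (walk_pmf w L s) x)
    = (\<Sum>j<L. exp (of_real s * (jump_char w L j - 1)) * residue_char L j (- x)) / of_nat L"
proof -
  have "(\<Sum>j<L. exp (of_real s * (jump_char w L j - 1)) * residue_char L j (- x))
    = (\<Sum>j<L. \<Sum>y\<in>{0..<int L}. of_real (pmf (walk_pmf w L s) y) * residue_char L j (y - x))"
    by (simp add: walk_char[OF assms(1,2), symmetric] sum_distrib_right mult.assoc
        residue_char_add[symmetric])
  also have "\<dots> = (\<Sum>y\<in>{0..<int L}. of_real (pmf (walk_pmf w L s) y) * (\<Sum>j<L. residue_char L j (y - x)))"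
    by (subst sum.swap) (simp add: sum_distrib_left)
  also have "\<dots> = (\<Sum>y\<in>{0..<int L}. if y = x then of_real (pmf (walk_pmf w L s) y) * of_nat L else 0)"
  proof (rule sum.cong[OF refl])
    fix y assume "y \<in> {0..<int L}"
    then have "int L dvd y - x \<longleftrightarrow> y = x"
      using assms(3) by (auto simp flip: mod_eq_dvd_iff)
    then show "of_real (pmf (walk_pmf w L s) y) * (\<Sum>j<L. residue_char L j (y - x))
      = (if y = x then of_real (pmf (walk_pmf w L s) y) * of_nat L else 0)"
      by (auto simp: residue_char_sum[OF assms(1)])
  qed
  also have "\<dots> = of_real (pmf (walk_pmf w L s) x) * of_nat L"
    using assms(3) by simp
  finally show ?thesis using assms(1) by simp
qed

lemma norm_exp_jump_char:
  "norm (exp (of_real s * (jump_char w L j - 1))) = exp (- s * (1 - cos (2 * pi * real j / real L)))"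
  by (simp add: Re_jump_char algebra_simps)

text \<open>
  The semigroup property. After Fourier inversion it only says that the characteristic functions
  at times \<open>s\<close> and \<open>t\<close> multiply to the one at time \<open>s + t\<close>.
\<close>

lemma walk_convolution:
  assumes "L > 0" "s \<ge> 0" "t \<ge> 0" "x \<in> {0..<int L}"
  shows "pmf (walk_pmf w L (s + t)) x
    = (\<Sum>y\<in>{0..<int L}. pmf (walk_pmf w L t) y * pmf (walk_pmf w L s) ((x - y) mod int L))"
proof -
  let ?E = "\<lambda>s j. exp (of_real s * (jump_char w L j - 1))"
  have rng: "(x - y) mod int L \<in> {0..<int L}" for y
    using assms(1) by simp
  have char: "residue_char L j (- ((x - y) mod int L)) = residue_char L j (- x) * residue_char L j y" for j y
    using residue_char_mod[OF assms(1), of j "- ((x - y) mod int L)"] residue_char_mod[OF assms(1), of j "y - x"]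
    by (simp add: mod_simps residue_char_add[symmetric])
  have "of_real (\<Sum>y\<in>{0..<int L}. pmf (walk_pmf w L t) y * pmf (walk_pmf w L s) ((x - y) mod int L))
    = (\<Sum>y\<in>{0..<int L}. \<Sum>j<L. ?E s j * residue_char L j (- x) / of_nat L
        * (of_real (pmf (walk_pmf w L t) y) * residue_char L j y))"
    by (simp add: walk_inversion[OF assms(1,2) rng] char sum_distrib_left sum_divide_distrib mult_ac)
  also have "\<dots> = (\<Sum>j<L. ?E s j * residue_char L j (- x) / of_nat L
      * (\<Sum>y\<in>{0..<int L}. of_real (pmf (walk_pmf w L t) y) * residue_char L j y))"
    by (subst sum.swap) (simp add: sum_distrib_left)
  also have "\<dots> = (\<Sum>j<L. ?E (s + t) j * residue_char L j (- x)) / of_nat L"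
    unfolding walk_char[OF assms(1,3)] sum_divide_distrib
    by (intro sum.cong refl) (simp add: distrib_right exp_add)
  also have "\<dots> = of_real (pmf (walk_pmf w L (s + t)) x)"
    using assms by (intro walk_inversion[symmetric]) auto
  finally show ?thesis
    by (simp only: of_real_eq_iff)
qed

section \<open>The law is flat\<close>

text \<open>
  With \<open>b = sqrt a\<close>, each term is at most \<open>2 / ((1 + b (j - 1)) (1 + b j))\<close>, which
  telescopes.
\<close>

lemma sum_inverse_quadratic_le:
  assumes "a > (0::real)"
  shows "(\<Sum>j=1..K. 1 / (1 + a * real j ^ 2)) \<le> 2 / sqrt a"
proof -
  define b where "b = sqrt a"
  have b: "b > 0" "a = b ^ 2"
    using assms by (auto simp: b_def)
  have "(\<Sum>j=1..K. 1 / (1 + a * real j ^ 2)) \<le> 2 / b * (1 - 1 / (1 + b * K))"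
  proof (induction K)
    case (Suc K)
    define u where "u = b * real K"
    define v where "v = b * real (Suc K)"
    have uv: "u \<ge> 0" "v = u + b"
      using b by (simp_all add: u_def v_def algebra_simps)
    have "(1 + u) * (1 + v) \<le> (1 + v) * (1 + v)"
      using uv b by (intro mult_right_mono) auto
    also have "\<dots> \<le> 2 * (1 + v ^ 2)"
      using zero_le_power2[of "1 - v"] by (simp add: power2_eq_square algebra_simps)
    finally have "1 / (1 + v ^ 2) \<le> 2 / ((1 + u) * (1 + v))"
      using uv b by (simp add: divide_simps add_pos_nonneg)
    also have "\<dots> = 2 / b * (1 / (1 + u) - 1 / (1 + v))"
      using uv b by (simp add: divide_simps add_pos_nonneg)
    finally have "1 / (1 + a * real (Suc K) ^ 2) \<le> 2 / b * (1 / (1 + u) - 1 / (1 + v))"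
      by (simp add: v_def b power_mult_distrib)
    moreover have "2 / b * (1 - 1 / (1 + v)) = 2 / b * (1 - 1 / (1 + u)) + 2 / b * (1 / (1 + u) - 1 / (1 + v))"
      by (simp only: distrib_left[symmetric]) simp
    ultimately show ?case
      using Suc by (simp add: u_def v_def del: of_nat_Suc)
  qed simp
  also have "\<dots> \<le> 2 / b * 1"
    using b by (intro mult_left_mono) auto
  finally show ?thesis by (simp add: b_def)
qed

text \<open>
  The normalising constant of the reference weights in \<open>walk_entropy_le\<close> is such a sum.
\<close>

lemma sum_int_inverse_quadratic_le:
  fixes c :: int
  assumes "a > (0::real)" "finite S"
  shows "(\<Sum>m\<in>S. 1 / (1 + a * real_of_int (m - c) ^ 2)) \<le> 1 + 4 / sqrt a"
proof -
  let ?g = "\<lambda>m::int. 1 / (1 + a * real_of_int m ^ 2)"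
  have g: "?g m \<ge> 0" for m
    using assms by (simp add: add_nonneg_nonneg)
  obtain K where K: "\<And>m. m \<in> S \<Longrightarrow> \<bar>m - c\<bar> \<le> int K"
  proof
    fix m assume m: "m \<in> S"
    have "nat \<bar>m - c\<bar> \<le> Max ((\<lambda>m. nat \<bar>m - c\<bar>) ` S)"
      using m assms by (intro Max_ge) auto
    then show "\<bar>m - c\<bar> \<le> int (Max ((\<lambda>m. nat \<bar>m - c\<bar>) ` S))"
      by linarith
  qed
  have inj: "inj_on (\<lambda>j. int j) {1..K}" "inj_on (\<lambda>j. - int j) {1..K}"
    by (auto simp: inj_on_def)
  have "(\<Sum>m\<in>S. ?g (m - c)) = (\<Sum>m\<in>(\<lambda>m. m - c) ` S. ?g m)"
    by (subst sum.reindex) (auto simp: inj_on_def)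
  also have "\<dots> \<le> (\<Sum>m\<in>{0} \<union> (int ` {1..K} \<union> (\<lambda>j. - int j) ` {1..K}). ?g m)"
  proof (rule sum_mono2)
    show "(\<lambda>m. m - c) ` S \<subseteq> {0} \<union> (int ` {1..K} \<union> (\<lambda>j. - int j) ` {1..K})"
    proof
      fix x assume "x \<in> (\<lambda>m. m - c) ` S"
      then have x: "\<bar>x\<bar> \<le> int K" using K by auto
      consider "x = 0" | "x > 0" | "x < 0" by linarith
      then show "x \<in> {0} \<union> (int ` {1..K} \<union> (\<lambda>j. - int j) ` {1..K})"
      proof cases
        case 2
        then have "x = int (nat x)" "nat x \<in> {1..K}" using x by auto
        then show ?thesis by blast
      next
        case 3
        then have "x = - int (nat (- x))" "nat (- x) \<in> {1..K}" using x by auto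
        then show ?thesis by blast
      qed simp
    qed
  qed (use g in auto)
  also have "\<dots> = ?g 0 + ((\<Sum>m\<in>int ` {1..K}. ?g m) + (\<Sum>m\<in>(\<lambda>j. - int j) ` {1..K}. ?g m))"
    by (subst sum.union_disjoint, simp, simp, force)+ simp
  also have "\<dots> = 1 + 2 * (\<Sum>j=1..K. 1 / (1 + a * real j ^ 2))"
    unfolding sum.reindex[OF inj(1)] sum.reindex[OF inj(2)] o_def by simp
  also have "\<dots> \<le> 1 + 2 * (2 / sqrt a)"
    by (intro add_left_mono mult_left_mono sum_inverse_quadratic_le assms) simp
  finally show ?thesis by simp
qed

text \<open>
  Jordan's inequality \<open>2 x / pi \<le> sin x\<close> at \<open>x = \<theta> / 2\<close>, from concavity of the sine.
\<close>

lemma one_minus_cos_ge: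
  assumes "0 \<le> \<theta>" "\<theta> \<le> pi"
  shows "2 * (\<theta> / pi) ^ 2 \<le> 1 - cos \<theta>"
proof -
  have "concave_on {0..pi/2} sin"
    by (rule f''_le0_imp_concave[where f' = cos and f'' = "\<lambda>x. - sin x"])
      (auto intro!: derivative_eq_intros sin_ge_zero)
  from concave_onD_Icc[OF this, of "\<theta> / pi"] assms have "\<theta> / pi \<le> sin (\<theta> / 2)"
    by simp
  then have "(\<theta> / pi) ^ 2 \<le> sin (\<theta> / 2) ^ 2"
    using assms by (intro power_mono) auto
  moreover have "cos \<theta> = 1 - 2 * sin (\<theta> / 2) ^ 2"
    using cos_double_sin[of "\<theta> / 2"] by simp
  ultimately show ?thesis by simp
qed

text \<open>
  By Fourier inversion the law is at most the average over the frequencies \<open>j\<close> of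
  \<open>exp (- s (1 - cos (2 pi j / L)))\<close>. The frequency \<open>0\<close> gives the term \<open>1 / L\<close>. The others
  behave like a Gaussian in the distance from \<open>j\<close> to \<open>0\<close> modulo \<open>L\<close> with width
  \<open>L / sqrt s\<close>; the bound \<open>exp (- u) \<le> 1 / (1 + u)\<close> reduces their sum to inverse
  quadratics.
\<close>

lemma pmf_walk_le:
  assumes "L > 0" "s > 0" "x \<in> {0..<int L}"
  shows "pmf (walk_pmf w L s) x \<le> 1 / real L + 2 / sqrt s"
proof -
  \<comment> \<open>The bound \<open>1 - cos (2 pi i / L) \<ge> 8 i\<^sup>2 / L\<^sup>2\<close> for \<open>2 i \<le> L\<close> turns the exponent into \<open>- a i\<^sup>2\<close>.\<close>
  define a where "a = 8 * s / real L ^ 2"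
  have a: "a > 0" using assms by (simp add: a_def)
  have exp_le: "exp (- s * (1 - cos (2 * pi * real i / real L))) \<le> 1 / (1 + a * real i ^ 2)" if "2 * i \<le> L" for i
  proof -
    have "2 * pi * real i / real L \<le> pi"
      using that assms by (simp add: field_simps)
    then have "2 * ((2 * pi * real i / real L) / pi) ^ 2 \<le> 1 - cos (2 * pi * real i / real L)"
      by (intro one_minus_cos_ge) auto
    then have "s * (8 * real i ^ 2 / real L ^ 2) \<le> s * (1 - cos (2 * pi * real i / real L))"
      using assms by (intro mult_left_mono) (auto simp: power_divide power_mult_distrib)
    then have "1 + a * real i ^ 2 \<le> 1 + s * (1 - cos (2 * pi * real i / real L))"
      by (simp add: a_def mult.left_commute mult.commute)
    also have "\<dots> \<le> exp (s * (1 - cos (2 * pi * real i / real L)))"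
      by (rule exp_ge_add_one_self)
    finally show ?thesis
      using a by (simp add: exp_minus divide_simps add_pos_nonneg)
  qed
  \<comment> \<open>One of \<open>j\<close> and \<open>L - j\<close> is at most \<open>L / 2\<close>; adding both bounds avoids splitting the sum over \<open>j\<close>.\<close>
  have paired: "exp (- s * (1 - cos (2 * pi * real j / real L)))
      \<le> 1 / (1 + a * real j ^ 2) + 1 / (1 + a * real (L - j) ^ 2)" if "j \<le> L" for j
  proof (cases "2 * j \<le> L")
    case True
    show ?thesis
      by (rule order_trans[OF exp_le[OF True]]) (use a in \<open>simp add: add_nonneg_nonneg\<close>)
  next
    case False
    have "2 * pi * real (L - j) / real L = 2 * pi - 2 * pi * real j / real L"
      using that assms by (simp add: of_nat_diff field_simps)
    then have "cos (2 * pi * real j / real L) = cos (2 * pi * real (L - j) / real L)"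
      by (simp add: cos_diff)
    then have "exp (- s * (1 - cos (2 * pi * real j / real L))) \<le> 1 / (1 + a * real (L - j) ^ 2)"
      using exp_le[of "L - j"] False by simp
    also have "\<dots> \<le> 1 / (1 + a * real j ^ 2) + 1 / (1 + a * real (L - j) ^ 2)"
      using a by (simp add: add_nonneg_nonneg)
    finally show ?thesis .
  qed
  have "pmf (walk_pmf w L s) x = norm (of_real (pmf (walk_pmf w L s) x) :: complex)"
    by simp
  also have "\<dots> = norm (\<Sum>j<L. exp (of_real s * (jump_char w L j - 1)) * residue_char L j (- x)) / L"
    using assms by (subst walk_inversion) (auto simp: norm_divide)
  also have "\<dots> \<le> (\<Sum>j<L. exp (- s * (1 - cos (2 * pi * real j / real L)))) / L"
    by (intro divide_right_mono sum_norm_le) (auto simp only: norm_mult norm_residue_char norm_exp_jump_char mult_1_right order_refl of_nat_0_le_iff)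
  also have "{..<L} = insert 0 {1..<L}"
    using assms by auto
  also have "(\<Sum>j\<in>insert 0 {1..<L}. exp (- s * (1 - cos (2 * pi * real j / real L))))
      = 1 + (\<Sum>j\<in>{1..<L}. exp (- s * (1 - cos (2 * pi * real j / real L))))"
    by (subst sum.insert) auto
  also have "(\<Sum>j\<in>{1..<L}. exp (- s * (1 - cos (2 * pi * real j / real L))))
      \<le> (\<Sum>j\<in>{1..<L}. 1 / (1 + a * real j ^ 2) + 1 / (1 + a * real (L - j) ^ 2))"
    by (intro sum_mono paired) auto
  also have "\<dots> = (\<Sum>j\<in>{1..<L}. 1 / (1 + a * real j ^ 2)) + (\<Sum>j\<in>{1..<L}. 1 / (1 + a * real j ^ 2))"
    unfolding sum.distrib
    by (intro arg_cong2[where f = "(+)"] refl sum.reindex_bij_witness[of _ "\<lambda>j. L - j" "\<lambda>j. L - j"]) auto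
  also have "(\<Sum>j\<in>{1..<L}. 1 / (1 + a * real j ^ 2)) \<le> 2 / sqrt a"
    using sum_inverse_quadratic_le[OF a, of "L - 1"] assms
    by (simp add: atLeastLessThanSuc_atLeastAtMost[symmetric])
  also have "2 / sqrt a \<le> real L / sqrt s"
    using assms by (simp add: a_def real_sqrt_divide real_sqrt_mult field_simps)
      (simp add: real_le_rsqrt)
  finally show ?thesis
    using assms by (simp add: field_simps)
qed

section \<open>Entropy as a function of time and of the cycle\<close>

text \<open>
  This is \<open>ln u \<le> u - 1\<close> at \<open>u = q / p\<close>. The case \<open>p = 0\<close> agrees with the convention that
  \<open>0\<close> times the logarithm of \<open>0\<close> is \<open>0\<close>.
\<close>

lemma gibbs_pointwise:
  fixes p q :: real
  assumes "p \<ge> 0" "q \<ge> 0" "p > 0 \<Longrightarrow> q > 0"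
  shows "p * (ln q - ln p) \<le> q - p" and "p \<noteq> q \<Longrightarrow> p * (ln q - ln p) < q - p"
proof -
  have *: "p * (ln q - ln p) \<le> q - p \<and> (p \<noteq> q \<longrightarrow> p * (ln q - ln p) < q - p)"
  proof (cases "p = 0")
    case False
    with assms have pq: "p > 0" "q > 0" by auto
    have "ln (q / p) \<le> q / p - 1"
      using pq by (intro ln_le_minus_one) auto
    moreover have "ln (q / p) \<noteq> q / p - 1" if "p \<noteq> q"
      using ln_eq_minus_one[of "q / p"] pq that by auto
    ultimately have "ln (q / p) \<le> q / p - 1 \<and> (p \<noteq> q \<longrightarrow> ln (q / p) < q / p - 1)"
      by (auto simp: less_le)
    then have "p * ln (q / p) \<le> p * (q / p - 1) \<and> (p \<noteq> q \<longrightarrow> p * ln (q / p) < p * (q / p - 1))"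
      using pq by simp
    then show ?thesis
      using pq by (simp add: ln_div right_diff_distrib)
  qed (use assms in auto)
  then show "p * (ln q - ln p) \<le> q - p" and "p \<noteq> q \<Longrightarrow> p * (ln q - ln p) < q - p"
    by auto
qed

lemma gibbs_inequality:
  fixes p q :: "'x \<Rightarrow> real"
  assumes "finite A" "\<And>x. x \<in> A \<Longrightarrow> p x \<ge> 0" "\<And>x. x \<in> A \<Longrightarrow> q x \<ge> 0"
    "\<And>x. x \<in> A \<Longrightarrow> p x > 0 \<Longrightarrow> q x > 0" "sum q A \<le> sum p A"
  shows "(\<Sum>x\<in>A. p x * ln (q x)) \<le> (\<Sum>x\<in>A. p x * ln (p x))"
    and "x \<in> A \<Longrightarrow> p x \<noteq> q x \<Longrightarrow> (\<Sum>x\<in>A. p x * ln (q x)) < (\<Sum>x\<in>A. p x * ln (p x))"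
proof -
  have split: "(\<Sum>x\<in>A. p x * (ln (q x) - ln (p x))) = (\<Sum>x\<in>A. p x * ln (q x)) - (\<Sum>x\<in>A. p x * ln (p x))"
    by (simp add: right_diff_distrib sum_subtractf)
  have "(\<Sum>x\<in>A. p x * (ln (q x) - ln (p x))) \<le> (\<Sum>x\<in>A. q x - p x)"
    using assms by (intro sum_mono gibbs_pointwise) auto
  then show "(\<Sum>x\<in>A. p x * ln (q x)) \<le> (\<Sum>x\<in>A. p x * ln (p x))"
    using assms(5) by (simp add: split sum_subtractf)
  assume "x \<in> A" "p x \<noteq> q x"
  then have "(\<Sum>x\<in>A. p x * (ln (q x) - ln (p x))) < (\<Sum>x\<in>A. q x - p x)"
    using assms by (intro sum_strict_mono_ex1 ballI gibbs_pointwise bexI[of _ x]) auto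
  then show "(\<Sum>x\<in>A. p x * ln (q x)) < (\<Sum>x\<in>A. p x * ln (p x))"
    using assms(5) by (simp add: split sum_subtractf)
qed

text \<open>
  Entropy is at least minus the logarithm of the largest atom.
\<close>

lemma walk_entropy_ge:
  assumes "L > 0" "s > 0"
  shows "walk_entropy w L s \<ge> - ln (1 / real L + 2 / sqrt s)"
proof -
  define B where "B = 1 / real L + 2 / sqrt s"
  have "(\<Sum>x\<in>{0..<int L}. pmf (walk_pmf w L s) x * ln (pmf (walk_pmf w L s) x))
    \<le> (\<Sum>x\<in>{0..<int L}. pmf (walk_pmf w L s) x * ln B)"
  proof (rule sum_mono)
    fix x assume "x \<in> {0..<int L}"
    then have "pmf (walk_pmf w L s) x \<le> B"
      unfolding B_def by (rule pmf_walk_le[OF assms])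
    then show "pmf (walk_pmf w L s) x * ln (pmf (walk_pmf w L s) x) \<le> pmf (walk_pmf w L s) x * ln B"
      by (cases "pmf (walk_pmf w L s) x = 0")
        (auto intro!: mult_left_mono ln_mono simp: pmf_pos)
  qed
  also have "\<dots> = ln B"
    by (simp add: sum_distrib_right[symmetric] sum_pmf_walk[OF assms(1)])
  finally show ?thesis
    by (simp add: walk_entropy_eq_sum[OF assms(1)] B_def)
qed

text \<open>
  The endpoint \<open>0\<close> matters: at time \<open>0\<close> all but one of the atoms vanish.
\<close>

lemma continuous_on_mult_ln: "continuous_on {0..} (\<lambda>t::real. t * ln t)"
  unfolding continuous_on_def
proof
  fix x :: real assume x: "x \<in> {0..}"
  show "((\<lambda>t. t * ln t) \<longlongrightarrow> x * ln x) (at x within {0..})"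
  proof (cases "x = 0")
    case True
    have "((\<lambda>t::real. t * ln t) \<longlongrightarrow> 0) (at_right 0)"
      by real_asymp
    moreover have "at (0::real) within {0..} = at_right 0"
      unfolding at_within_def by (intro arg_cong2[where f = inf] arg_cong[where f = principal]) auto
    ultimately show ?thesis using True by simp
  next
    case False
    with x have "isCont (\<lambda>t. t * ln t) x"
      by (auto intro!: continuous_intros)
    then show ?thesis
      unfolding isCont_def by (rule tendsto_within_subset) simp
  qed
qed

lemma continuous_on_walk_entropy:
  assumes "L > 0"
  shows "continuous_on {0..} (walk_entropy w L)"
proof -
  have "continuous_on {0..} (\<lambda>s. pmf (walk_pmf w L s) x)" if "x \<in> {0..<int L}" for x
  proof -
    have "continuous_on {0..} (\<lambda>s. Re ((\<Sum>j<L. exp (of_real s * (jump_char w L j - 1)) * residue_char L j (- x)) / of_nat L))"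
      using assms by (intro continuous_intros) auto
    then show ?thesis
      by (rule continuous_on_eq) (simp add: walk_inversion[OF assms _ that, symmetric])
  qed
  then have "continuous_on {0..} (\<lambda>s. pmf (walk_pmf w L s) x * ln (pmf (walk_pmf w L s) x))"
    if "x \<in> {0..<int L}" for x
    using that by (intro continuous_on_compose2[OF continuous_on_mult_ln]) auto
  then show ?thesis
    unfolding walk_entropy_eq_sum[OF assms]
    by (intro continuous_on_minus continuous_on_sum) auto
qed

lemma pmf_walk_0_pos:
  assumes "s \<ge> 0"
  shows "pmf (walk_pmf w L s) 0 > 0"
proof -
  have "0 \<in> set_pmf (jump_count_pmf s)"
    by (simp add: set_pmf_iff pmf_jump_count[OF assms])
  moreover have "0 \<in> set_pmf (jump_chain_pmf w L 0)"
    by simp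
  ultimately have "0 \<in> set_pmf (walk_pmf w L s)"
    unfolding walk_pmf_def set_bind_pmf by blast
  then show ?thesis
    by (rule pmf_positive)
qed

text \<open>
  The characteristic function at frequency \<open>1\<close> has modulus
  \<open>exp (- s (1 - cos (2 pi / L)))\<close>, which decreases strictly in \<open>s\<close> once \<open>L \<ge> 2\<close>.
\<close>

lemma walk_law_changes:
  assumes "L \<ge> 2" "s \<ge> 0" "t > s"
  shows "\<exists>x\<in>{0..<int L}. pmf (walk_pmf w L s) x \<noteq> pmf (walk_pmf w L t) x"
proof (rule ccontr)
  assume "\<not> ?thesis"
  then have "(\<Sum>x\<in>{0..<int L}. of_real (pmf (walk_pmf w L s) x) * residue_char L 1 x)
    = (\<Sum>x\<in>{0..<int L}. of_real (pmf (walk_pmf w L t) x) * residue_char L 1 x)"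
    by (intro sum.cong) auto
  then have "exp (of_real s * (jump_char w L 1 - 1)) = exp (of_real t * (jump_char w L 1 - 1))"
    using assms by (simp add: walk_char)
  from arg_cong[OF this, of norm] have "s * (1 - cos (2 * pi / real L)) = t * (1 - cos (2 * pi / real L))"
    unfolding norm_exp_jump_char by simp
  with assms(3) have "cos (2 * pi / real L) = 1"
    by simp
  then obtain q :: int where "2 * pi / real L = q * 2 * pi"
    by (auto simp: cos_one_2pi_int)
  then have "1 = real_of_int (q * int L)"
    using assms by (simp add: field_simps)
  then have "1 = q * int L"
    by (metis of_int_1 of_int_eq_iff)
  then have "int L dvd 1"
    by (metis dvd_triv_right)
  with assms show False by simp
qed

lemma bij_betw_mod_shift:
  fixes y :: int
  assumes "L > 0"
  shows "bij_betw (\<lambda>x. (x - y) mod int L) {0..<int L} {0..<int L}"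
  by (rule bij_betw_byWitness[where f' = "\<lambda>x. (x + y) mod int L"])
    (use assms in \<open>auto simp: mod_simps\<close>)

text \<open>
  Write the law \<open>r\<close> at time \<open>t\<close> as the mixture of the shifts of the law \<open>p\<close> at time \<open>s\<close>,
  with the law \<open>q\<close> at time \<open>t - s\<close> as mixing weights. The increase of the entropy is then the
  \<open>q\<close>-average of the relative entropies \<open>D y\<close> of the shift by \<open>y\<close> with respect to \<open>r\<close>. All of
  them are nonnegative, and the unshifted one is positive and has positive weight.
\<close>

lemma walk_entropy_less:
  assumes L: "L \<ge> 2" and s: "s \<ge> 0" "t > s"
  shows "walk_entropy w L s < walk_entropy w L t"
proof -
  let ?A = "{0..<int L}"
  define p where "p = pmf (walk_pmf w L s)"
  define q where "q = pmf (walk_pmf w L (t - s))"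
  define r where "r = pmf (walk_pmf w L t)"
  have L0: "L > 0" using L by simp
  have nn: "p x \<ge> 0" "q x \<ge> 0" "r x \<ge> 0" for x
    by (simp_all add: p_def q_def r_def)
  have r_eq: "r x = (\<Sum>y\<in>?A. q y * p ((x - y) mod int L))" if "x \<in> ?A" for x
    using walk_convolution[OF L0 s(1) _ that, of "t - s" w] s by (simp add: p_def q_def r_def)
  define D where "D y = (\<Sum>x\<in>?A. p x * ln (p x)) - (\<Sum>x\<in>?A. p ((x - y) mod int L) * ln (r x))" for y
  have reindex: "(\<Sum>x\<in>?A. f (p ((x - y) mod int L))) = (\<Sum>x\<in>?A. f (p x))" for f :: "real \<Rightarrow> real" and y
    using sum.reindex_bij_betw[OF bij_betw_mod_shift[OF L0], of "\<lambda>x. f (p x)" y] by simp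
  have D_alt: "D y = (\<Sum>x\<in>?A. p ((x - y) mod int L) * ln (p ((x - y) mod int L)))
      - (\<Sum>x\<in>?A. p ((x - y) mod int L) * ln (r x))" for y
    using reindex[of "\<lambda>u. u * ln u"] by (simp add: D_def)
  have sums: "(\<Sum>x\<in>?A. r x) \<le> (\<Sum>x\<in>?A. p ((x - y) mod int L))" for y
    using reindex[of "\<lambda>u. u"] by (simp add: p_def r_def sum_pmf_walk[OF L0])
  have pos: "r x > 0" if "x \<in> ?A" "y \<in> ?A" "q y > 0" "p ((x - y) mod int L) > 0" for x y
  proof -
    have "0 < q y * p ((x - y) mod int L)" using that by simp
    also have "\<dots> \<le> r x"
      unfolding r_eq[OF that(1)] using that nn by (intro member_le_sum) auto
    finally show ?thesis .
  qed
  have D_nonneg: "q y * D y \<ge> 0" if "y \<in> ?A" for y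
  proof (cases "q y = 0")
    case False
    then have "q y > 0" using nn[of y] by linarith
    then have "(\<Sum>x\<in>?A. p ((x - y) mod int L) * ln (r x))
      \<le> (\<Sum>x\<in>?A. p ((x - y) mod int L) * ln (p ((x - y) mod int L)))"
      by (intro gibbs_inequality(1) sums nn pos[OF _ that]) auto
    then have "D y \<ge> 0"
      unfolding D_alt by simp
    then show ?thesis using nn by simp
  qed simp
  have q0: "q 0 > 0"
    using s pmf_walk_0_pos by (simp add: q_def)
  obtain x where x: "x \<in> ?A" "p x \<noteq> r x"
    using walk_law_changes[OF L s, of w] by (auto simp: p_def r_def)
  have "D 0 > 0"
    unfolding D_alt
    using gibbs_inequality(2)[of ?A "\<lambda>x. p (x mod int L)" r x] x nn sums[of 0] pos[of _ 0] q0 L0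
    by simp
  then have "q 0 * D 0 > 0" using q0 by simp
  then have "0 < (\<Sum>y\<in>?A. q y * D y)"
    using D_nonneg L0 by (intro sum_pos2[of _ 0]) auto
  also have "\<dots> = (\<Sum>y\<in>?A. q y) * (\<Sum>x\<in>?A. p x * ln (p x))
      - (\<Sum>y\<in>?A. \<Sum>x\<in>?A. q y * p ((x - y) mod int L) * ln (r x))"
    by (simp add: D_def right_diff_distrib sum_subtractf sum_distrib_left[symmetric] sum_distrib_right[symmetric] mult.assoc)
  also have "(\<Sum>y\<in>?A. \<Sum>x\<in>?A. q y * p ((x - y) mod int L) * ln (r x)) = (\<Sum>x\<in>?A. r x * ln (r x))"
    by (subst sum.swap) (simp add: r_eq sum_distrib_right)
  also have "(\<Sum>y\<in>?A. q y) = 1"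
    by (simp add: q_def sum_pmf_walk[OF L0])
  finally show ?thesis
    by (simp add: walk_entropy_eq_sum[OF L0] p_def r_def)
qed

lemma walk_entropy_0:
  assumes "L > 0"
  shows "walk_entropy w L 0 = 0"
proof -
  have "walk_pmf w L 0 = return_pmf 0"
    by (simp add: walk_pmf_def jump_count_pmf_def bind_return_pmf)
  then show ?thesis
    by (auto simp: walk_entropy_eq_sum[OF assms] pmf_return intro!: sum.neutral)
qed

text \<open>
  Projecting a random variable cannot increase its entropy: every atom is at most the atom of the
  projection that contains it.
\<close>

lemma walk_entropy_dvd_le:
  assumes "L' dvd L" "L > 0"
  shows "walk_entropy w L' s \<le> walk_entropy w L s"
proof -
  let ?A = "{0..<int L}" and ?A' = "{0..<int L'}"
  define p where "p = pmf (walk_pmf w L s)"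
  define p' where "p' = pmf (walk_pmf w L' s)"
  have L': "L' > 0" using assms by (auto intro: dvd_pos_nat)
  have fib: "p' y = (\<Sum>x\<in>{x \<in> ?A. x mod int L' = y}. p x)" for y
  proof -
    have "p' y = measure (walk_pmf w L s) ((\<lambda>x. x mod int L') -` {y})"
      by (simp add: p'_def walk_pmf_mod[OF assms(1)] pmf_map)
    also have "\<dots> = measure (walk_pmf w L s) {x \<in> ?A. x mod int L' = y}"
      using set_pmf_walk[OF assms(2), of w s]
      by (intro measure_prob_cong_0) (auto simp: set_pmf_iff)
    also have "\<dots> = (\<Sum>x\<in>{x \<in> ?A. x mod int L' = y}. p x)"
      unfolding p_def by (rule measure_measure_pmf_finite) (rule finite_subset[of _ ?A], auto)
    finally show ?thesis .
  qed
  have "- walk_entropy w L s = (\<Sum>x\<in>?A. p x * ln (p x))"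
    by (simp add: walk_entropy_eq_sum[OF assms(2)] p_def)
  also have "\<dots> \<le> (\<Sum>x\<in>?A. p x * ln (p' (x mod int L')))"
  proof (rule sum_mono)
    fix x assume x: "x \<in> ?A"
    have "p x \<le> p' (x mod int L')"
      unfolding fib using x by (intro member_le_sum finite_subset[of "{x' \<in> ?A. x' mod int L' = x mod int L'}" ?A]) (auto simp: p_def)
    then show "p x * ln (p x) \<le> p x * ln (p' (x mod int L'))"
      by (cases "p x = 0") (auto intro!: mult_left_mono ln_mono simp: p_def pmf_pos)
  qed
  also have "\<dots> = (\<Sum>y\<in>?A'. \<Sum>x\<in>{x \<in> ?A. x mod int L' = y}. p x * ln (p' (x mod int L')))"
    using L' by (intro sum.group[symmetric]) auto
  also have "\<dots> = (\<Sum>y\<in>?A'. p' y * ln (p' y))"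
    by (simp only: fib sum_distrib_right) (intro sum.cong refl, simp)
  also have "\<dots> = - walk_entropy w L' s"
    by (simp add: walk_entropy_eq_sum[OF L'] p'_def)
  finally show ?thesis by simp
qed

section \<open>An upper bound for the entropy\<close>

lemma poisson_factorial_moments:
  shows "(\<lambda>m. s ^ m / fact m * exp (- s)) sums (1 :: real)"
    and "(\<lambda>m. s ^ m / fact m * exp (- s) * real m) sums s"
    and "(\<lambda>m. s ^ m / fact m * exp (- s) * (real m * (real m - 1))) sums s ^ 2"
proof -
  have "(\<lambda>m. s ^ m / fact m * exp (- s)) sums (exp s * exp (- s))"
    using sums_mult2[OF exp_converges[of s], of "exp (- s)"] by (simp add: field_simps)
  then show 0: "(\<lambda>m. s ^ m / fact m * exp (- s)) sums 1"
    by (simp add: exp_minus)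
  have "(\<lambda>m. s ^ Suc m / fact (Suc m) * exp (- s) * real (Suc m)) sums s"
    using sums_mult[OF 0, of s] by (simp add: mult_ac del: of_nat_Suc)
  then show 1: "(\<lambda>m. s ^ m / fact m * exp (- s) * real m) sums s"
    by (subst (asm) sums_Suc_iff) simp
  have "(\<lambda>m. s ^ Suc m / fact (Suc m) * exp (- s) * (real (Suc m) * (real (Suc m) - 1))) sums s ^ 2"
    using sums_mult[OF 1, of s] by (simp add: mult_ac power2_eq_square del: of_nat_Suc) (simp add: mult_ac)
  then show "(\<lambda>m. s ^ m / fact m * exp (- s) * (real m * (real m - 1))) sums s ^ 2"
    by (subst (asm) sums_Suc_iff) simp
qed

lemma jump_chain_second_moment_Simple:
  "(\<integral>x. real_of_int x ^ 2 \<partial>jump_chain_pmf Simple 0 m) = real m"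
proof (induction m)
  case (Suc m)
  let ?M = "jump_chain_pmf Simple 0 m"
  have step: "(\<integral>\<xi>. real_of_int (x + \<xi>) ^ 2 \<partial>pmf_of_set {- 1, 1}) = real_of_int x ^ 2 + 1" for x
    by (subst integral_measure_pmf[where A = "{-1, 1}"]) (auto simp: power2_eq_square algebra_simps)
  have "(\<integral>x. real_of_int x ^ 2 \<partial>jump_chain_pmf Simple 0 (Suc m))
    = (\<Sum>x\<in>set_pmf ?M. pmf ?M x *\<^sub>R
        (\<integral>y. real_of_int y ^ 2 \<partial>map_pmf (\<lambda>\<xi>. (x + \<xi>) mod int 0) (jump_pmf Simple)))"
    unfolding jump_chain_pmf.simps
    by (rule pmf_expectation_bind) (auto simp: finite_set_pmf_jump_chain)
  also have "\<dots> = (\<Sum>x\<in>set_pmf ?M. pmf ?M x *\<^sub>R real_of_int x ^ 2) + (\<Sum>x\<in>set_pmf ?M. pmf ?M x)"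
    using step by (simp add: distrib_left sum.distrib)
  also have "(\<Sum>x\<in>set_pmf ?M. pmf ?M x *\<^sub>R real_of_int x ^ 2) = (\<integral>x. real_of_int x ^ 2 \<partial>?M)"
    by (rule integral_measure_pmf[symmetric]) (auto simp: finite_set_pmf_jump_chain)
  also have "(\<Sum>x\<in>set_pmf ?M. pmf ?M x) = 1"
    by (rule sum_pmf_eq_1) (auto simp: finite_set_pmf_jump_chain)
  finally show ?case by (simp add: Suc)
qed simp

lemma jump_chain_Directed: "jump_chain_pmf Directed 0 m = return_pmf (int m)"
  by (induction m) (simp_all add: bind_return_pmf add.commute)

text \<open>
  The variance of either walk on the integers is \<open>s\<close>. The directed walk has mean \<open>s\<close>, which is
  rounded down to an integer \<open>c\<close>; this costs the square of the fractional part of \<open>s\<close>, which is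
  at most \<open>s\<close> also for small \<open>s\<close>.
\<close>

lemma walk_second_moment:
  assumes "s \<ge> 0"
  obtains c :: int and V where "V \<le> 2 * s"
    "(\<lambda>m. s ^ m / fact m * exp (- s) * (\<integral>x. real_of_int (x - c) ^ 2 \<partial>jump_chain_pmf w 0 m)) sums V"
proof (cases w)
  case Simple
  show ?thesis
  proof
    show "(\<lambda>m. s ^ m / fact m * exp (- s) * (\<integral>x. real_of_int (x - 0) ^ 2 \<partial>jump_chain_pmf w 0 m)) sums s"
      using poisson_factorial_moments(2)[of s] by (simp add: Simple jump_chain_second_moment_Simple)
  qed (use assms in simp)
next
  case Directed
  define c where "c = \<lfloor>s\<rfloor>"
  have f: "0 \<le> s - c" "s - c \<le> 1" "c \<ge> 0"
    using assms by (auto simp: c_def) linarith+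
  show ?thesis
  proof
    have "(s - c) ^ 2 \<le> s - c"
      using f by (simp add: power2_eq_square mult_left_le)
    then show "s + (s - c) ^ 2 \<le> 2 * s"
      using f by linarith
    have "(\<lambda>m. s ^ m / fact m * exp (- s) * (real m * (real m - 1))
        + s ^ m / fact m * exp (- s) * real m * (1 - 2 * c) + s ^ m / fact m * exp (- s) * real_of_int c ^ 2)
      sums (s ^ 2 + s * (1 - 2 * c) + 1 * real_of_int c ^ 2)"
      by (intro sums_add sums_mult2 poisson_factorial_moments)
    moreover have "s ^ 2 + s * (1 - 2 * c) + 1 * real_of_int c ^ 2 = s + (s - c) ^ 2"
      by (simp add: power2_eq_square algebra_simps)
    moreover have expand: "u * (x * (x - 1)) + u * x * (1 - 2 * c) + u * real_of_int c ^ 2 = u * (x - c) ^ 2"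
      for u x :: real
      by (simp add: power2_eq_square algebra_simps)
    moreover have "s ^ m / fact m * exp (- s) * (real m * (real m - 1))
        + s ^ m / fact m * exp (- s) * real m * (1 - 2 * c) + s ^ m / fact m * exp (- s) * real_of_int c ^ 2
      = s ^ m / fact m * exp (- s) * (\<integral>x. real_of_int (x - c) ^ 2 \<partial>jump_chain_pmf w 0 m)" for m
      unfolding Directed jump_chain_Directed
      using expand[of "s ^ m / fact m * exp (- s)" "real m"] by simp
    ultimately show "(\<lambda>m. s ^ m / fact m * exp (- s) *
        (\<integral>x. real_of_int (x - c) ^ 2 \<partial>jump_chain_pmf w 0 m)) sums (s + (s - c) ^ 2)"
      by simp
  qed
qed

text \<open>
  The entropy is at most the cross entropy with respect to any probability weights. The weights
  taken here are proportional to \<open>1 / (1 + a (m - c)\<^sup>2)\<close>, where \<open>m\<close> is the representative of the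
  residue closest to the centre \<open>c\<close> of the walk on the integers. Their logarithms are controlled by
  the second moment, which only decreases when the walk is projected and moved to the closest
  representative. The parameter \<open>a\<close> stays free because large and small times need different
  choices: for large \<open>s\<close> the bound must grow like \<open>ln (sqrt s)\<close>, and for small \<open>s\<close> it must
  vanish, in both cases uniformly in \<open>L\<close>.
\<close>

lemma walk_entropy_le:
  assumes "L > 0" "s \<ge> 0" "a > 0"
  shows "walk_entropy w L s \<le> ln (1 + 4 / sqrt a) + 2 * a * s"
proof -
  let ?A = "{0..<int L}"
  obtain c :: int and V where V: "V \<le> 2 * s"
    and V_sums: "(\<lambda>m. s ^ m / fact m * exp (- s) * (\<integral>x. real_of_int (x - c) ^ 2 \<partial>jump_chain_pmf w 0 m)) sums V"
    using walk_second_moment[OF assms(2)] .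
  define rep where "rep x = arg_min (\<lambda>m. nat \<bar>m - c\<bar>) (\<lambda>m. m mod int L = x)" for x
  have rep: "rep (m mod int L) mod int L = m mod int L" "\<bar>rep (m mod int L) - c\<bar> \<le> \<bar>m - c\<bar>" for m
  proof -
    have *: "rep (m mod int L) mod int L = m mod int L \<and>
      (\<forall>m'. m' mod int L = m mod int L \<longrightarrow> nat \<bar>rep (m mod int L) - c\<bar> \<le> nat \<bar>m' - c\<bar>)"
      unfolding rep_def by (rule arg_min_nat_lemma) simp
    then show "rep (m mod int L) mod int L = m mod int L" by blast
    from * have "nat \<bar>rep (m mod int L) - c\<bar> \<le> nat \<bar>m - c\<bar>" by blast
    then show "\<bar>rep (m mod int L) - c\<bar> \<le> \<bar>m - c\<bar>" by simp
  qed
  have inj: "inj_on rep ?A"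
  proof (rule inj_onI)
    fix x y assume "x \<in> ?A" "y \<in> ?A" "rep x = rep y"
    with rep(1)[of x] rep(1)[of y] show "x = y" by simp
  qed
  define p where "p = pmf (walk_pmf w L s)"
  define f where "f x = real_of_int (rep x - c) ^ 2" for x
  define Z where "Z = (\<Sum>x\<in>?A. 1 / (1 + a * f x))"
  have f: "f x \<ge> 0" for x by (simp add: f_def)
  have p: "p x \<ge> 0" "sum p ?A = 1" for x
    by (simp_all add: p_def sum_pmf_walk[OF assms(1)])
  have den: "1 + a * f x > 0" for x
    using assms(3) f[of x] by (simp add: add_pos_nonneg)
  have "Z = (\<Sum>m\<in>rep ` ?A. 1 / (1 + a * real_of_int (m - c) ^ 2))"
    by (simp add: Z_def f_def sum.reindex[OF inj])
  also have "\<dots> \<le> 1 + 4 / sqrt a"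
    using assms by (intro sum_int_inverse_quadratic_le) auto
  finally have Z_le: "Z \<le> 1 + 4 / sqrt a" .
  have Z_pos: "Z > 0"
    unfolding Z_def using assms(1) den by (intro sum_pos) auto
  have "(\<Sum>x\<in>?A. p x * ln (1 / (1 + a * f x) / Z)) \<le> (\<Sum>x\<in>?A. p x * ln (p x))"
  proof (rule gibbs_inequality(1))
    show "(\<Sum>x\<in>?A. 1 / (1 + a * f x) / Z) \<le> sum p ?A"
      unfolding sum_divide_distrib[symmetric] Z_def[symmetric] using Z_pos by (simp add: p)
  qed (use p Z_pos in \<open>auto intro!: divide_nonneg_pos divide_pos_pos mult_pos_pos less_imp_le[OF mult_pos_pos] den\<close>)
  then have "walk_entropy w L s \<le> - (\<Sum>x\<in>?A. p x * ln (1 / (1 + a * f x) / Z))"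
    by (simp add: walk_entropy_eq_sum[OF assms(1)] p_def)
  also have "\<dots> = (\<Sum>x\<in>?A. p x * (ln (1 + a * f x) + ln Z))"
  proof -
    have "ln (1 / (1 + a * f x) / Z) = - (ln (1 + a * f x) + ln Z)" for x
      using Z_pos den[of x] by (simp add: ln_div ln_mult)
    then show ?thesis by (simp only: mult_minus_right sum_negf minus_minus)
  qed
  also have "\<dots> \<le> (\<Sum>x\<in>?A. p x * (a * f x + ln Z))"
    using p f assms(3) by (intro sum_mono mult_left_mono add_mono ln_add_one_self_le_self) auto
  also have "\<dots> = a * (\<Sum>x\<in>?A. p x * f x) + ln Z"
    by (simp add: distrib_left sum.distrib sum_distrib_left[symmetric] sum_distrib_right[symmetric] p mult.left_commute)
  finally have 1: "walk_entropy w L s \<le> a * (\<Sum>x\<in>?A. p x * f x) + ln Z" .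
  have 2: "(\<Sum>x\<in>?A. p x * f x) \<le> V"
  proof (rule sums_le)
    show "(\<lambda>m. (s ^ m / fact m * exp (- s)) *\<^sub>R (\<integral>x. f x \<partial>jump_chain_pmf w L m)) sums (\<Sum>x\<in>?A. p x * f x)"
      using walk_expectation_sums[OF assms(2,1), of w f] by (simp add: p_def)
    fix m
    have "(\<integral>x. f x \<partial>jump_chain_pmf w L m) = (\<integral>x. f (x mod int L) \<partial>jump_chain_pmf w 0 m)"
      by (simp add: jump_chain_pmf_mod[of L 0])
    also have "\<dots> \<le> (\<integral>x. real_of_int (x - c) ^ 2 \<partial>jump_chain_pmf w 0 m)"
    proof (rule integral_mono)
      show "f (x mod int L) \<le> real_of_int (x - c) ^ 2" for x
        unfolding f_def using rep(2)[of x] by (subst abs_le_square_iff[symmetric]) linarith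
    qed (auto intro!: integrable_measure_pmf_finite finite_set_pmf_jump_chain)
    finally show "(s ^ m / fact m * exp (- s)) *\<^sub>R (\<integral>x. f x \<partial>jump_chain_pmf w L m)
      \<le> s ^ m / fact m * exp (- s) * (\<integral>x. real_of_int (x - c) ^ 2 \<partial>jump_chain_pmf w 0 m)"
      using assms(2) by (simp only: real_scaleR_def) (intro mult_left_mono, auto)
  qed (rule V_sums)
  have "walk_entropy w L s \<le> a * (2 * s) + ln (1 + 4 / sqrt a)"
    using 1 mult_left_mono[OF order_trans[OF 2 V], of a] ln_mono[OF Z_le Z_pos] assms(3) by linarith
  then show ?thesis by simp
qed

section \<open>Quotients of an Abelian group by its multiples\<close>

lemma (in comm_group) subgroup_multiples: "subgroup (multiples L G) G"
proof (rule subgroupI)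
  show "multiples L G \<subseteq> carrier G"
    by (auto simp: multiples_def)
  show "multiples L G \<noteq> {}"
    by (auto simp: multiples_def)
next
  fix a assume "a \<in> multiples L G"
  then obtain x where x: "x \<in> carrier G" "a = x [^] L"
    by (auto simp: multiples_def)
  then have "inv a = (inv x) [^] L"
    by (simp add: nat_pow_inv)
  with x show "inv a \<in> multiples L G"
    by (auto simp: multiples_def)
next
  fix a b assume "a \<in> multiples L G" "b \<in> multiples L G"
  then obtain x y where "x \<in> carrier G" "a = x [^] L" "y \<in> carrier G" "b = y [^] L"
    by (auto simp: multiples_def)
  then have "a \<otimes> b = (x \<otimes> y) [^] L" "x \<otimes> y \<in> carrier G"
    by (simp_all add: nat_pow_distrib)
  then show "a \<otimes> b \<in> multiples L G"
    by (auto simp: multiples_def)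
qed

lemma (in comm_group) normal_multiples: "multiples L G \<lhd> G"
  using subgroup_multiples by (rule subgroup_imp_normal)

text \<open>
  Induction on the generators: adjoining \<open>g\<close> to \<open>S\<close> gives the products of powers of \<open>g\<close> with
  exponent below \<open>L\<close> and elements of the group generated by \<open>S\<close>, because these products
  already form a subgroup.
\<close>

lemma (in comm_group) card_generate_le:
  fixes L :: nat
  assumes "finite S" "S \<subseteq> carrier G" "L > 0" "\<And>x. x \<in> carrier G \<Longrightarrow> x [^] L = \<one>"
  shows "finite (generate G S) \<and> card (generate G S) \<le> L ^ card S"
  using assms(1,2)
proof (induction S rule: finite_induct)
  case empty
  then show ?case by (simp add: generate_empty)
next
  case (insert g S)
  then have g: "g \<in> carrier G" and S: "S \<subseteq> carrier G" by auto
  let ?H = "generate G S"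
  have H: "subgroup ?H G" using S by (rule generate_is_subgroup)
  note HC = subgroup.mem_carrier[OF H]
  define T where "T = (\<lambda>(i, y). g [^] i \<otimes> y) ` ({..<L} \<times> ?H)"
  have T: "g [^] (i :: nat) \<otimes> y \<in> T" if "y \<in> ?H" for i y
  proof -
    have "g [^] i = g [^] (L * (i div L) + i mod L)"
      by simp
    also have "\<dots> = (g [^] L) [^] (i div L) \<otimes> g [^] (i mod L)"
      using g by (simp only: nat_pow_mult[symmetric] nat_pow_pow)
    also have "\<dots> = g [^] (i mod L)"
      using g assms(4) by simp
    finally show ?thesis
      using that assms(3) by (auto simp: T_def intro!: image_eqI[of _ _ "(i mod L, y)"])
  qed
  have "generate G (insert g S) \<subseteq> T"
  proof
    fix x assume "x \<in> generate G (insert g S)"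
    then show "x \<in> T"
    proof (induction rule: generate.induct)
      case one
      show ?case using T[of \<one> 0] subgroup.one_closed[OF H] by simp
    next
      case (incl h)
      then show ?case
        using T[of \<one> 1] T[of h 0] subgroup.one_closed[OF H] g S generate.incl[of h S G] by auto
    next
      case (inv h)
      then consider "h = g" | "h \<in> S" by blast
      then show ?case
      proof cases
        case 1
        have "g [^] (L - 1) \<otimes> g = \<one>"
          using assms(3,4) g nat_pow_Suc[of g "L - 1"] by simp
        then have "inv g = g [^] (L - 1)"
          using g by (simp add: inv_equality)
        then show ?thesis
          using 1 T[of \<one> "L - 1"] subgroup.one_closed[OF H] g by simp
      next
        case 2
        then show ?thesis
          using T[of "inv h" 0] generate.inv[of h S G] S by auto
      qed
    next
      case (eng h1 h2)
      then obtain i y j z where *: "y \<in> ?H" "z \<in> ?H" "h1 = g [^] (i::nat) \<otimes> y" "h2 = g [^] (j::nat) \<otimes> z"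
        by (auto simp: T_def)
      then have "h1 \<otimes> h2 = g [^] (i + j) \<otimes> (y \<otimes> z)"
        using g HC by (simp add: nat_pow_mult[symmetric] m_ac)
      then show ?case
        using T subgroup.m_closed[OF H] * by simp
    qed
  qed
  moreover have fin: "finite ({..<L} \<times> ?H)"
    using insert.IH S by simp
  then have "finite T" by (simp add: T_def)
  moreover have "card T \<le> L * card ?H"
    using card_image_le[OF fin] by (simp add: T_def card_cartesian_product)
  moreover have "L * card ?H \<le> L ^ card (insert g S)"
    using insert.IH insert.hyps S by simp
  ultimately show ?case
    by (meson card_mono finite_subset order_trans)
qed

lemma (in comm_group) min_generators_witness:
  assumes "finite (carrier G)"
  obtains S where "S \<subseteq> carrier G" "finite S" "card S = min_generators G" "generate G S = carrier G"
proof -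
  have "generate G (carrier G) = carrier G"
    by (intro equalityI generate_incl subset_refl subsetI generate.incl)
  then have "\<exists>S\<subseteq>carrier G. finite S \<and> card S = card (carrier G) \<and> generate G S = carrier G"
    using assms by (intro exI[of _ "carrier G"]) simp
  then have "\<exists>S\<subseteq>carrier G. finite S \<and> card S = min_generators G \<and> generate G S = carrier G"
    unfolding min_generators_def by (rule LeastI)
  then show ?thesis using that by blast
qed

lemma (in comm_group) order_Mod_multiples_le_power:
  assumes "finite (carrier G)" "L > 0"
  shows "order (G Mod multiples L G) \<le> L ^ min_generators G"
proof -
  let ?N = "multiples L G"
  interpret N: normal ?N G by (rule normal_multiples)
  interpret Q: comm_group "G Mod ?N"
    by (rule abelian_FactGroup[OF subgroup_multiples])
  obtain S where S: "S \<subseteq> carrier G" "finite S" "card S = min_generators G" "generate G S = carrier G"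
    using min_generators_witness[OF assms(1)] .
  interpret h: group_hom G "G Mod ?N" "\<lambda>a. ?N #> a"
    by unfold_locales (rule N.r_coset_hom_Mod)
  have surj: "(\<lambda>a. ?N #> a) ` carrier G = carrier (G Mod ?N)"
    by (simp only: carrier_FactGroup)
  have "X [^]\<^bsub>G Mod ?N\<^esub> L = \<one>\<^bsub>G Mod ?N\<^esub>" if "X \<in> carrier (G Mod ?N)" for X
  proof -
    from that obtain a where a: "a \<in> carrier G" "X = ?N #> a"
      unfolding surj[symmetric] by (rule imageE)
    have "X [^]\<^bsub>G Mod ?N\<^esub> L = ?N #> (a [^] L)"
      unfolding a(2) by (rule N.FactGroup_pow[OF a(1)])
    also have "\<dots> = ?N"
      by (rule coset_join2[OF nat_pow_closed[OF a(1)] subgroup_multiples]) (use a(1) in \<open>unfold multiples_def, blast\<close>)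
    finally show ?thesis by (simp only: one_FactGroup)
  qed
  moreover have "(\<lambda>a. ?N #> a) ` S \<subseteq> carrier (G Mod ?N)"
    unfolding surj[symmetric] using S(1) by (rule image_mono)
  ultimately have "card (generate (G Mod ?N) ((\<lambda>a. ?N #> a) ` S)) \<le> L ^ card ((\<lambda>a. ?N #> a) ` S)"
    using Q.card_generate_le[OF finite_imageI[OF S(2)] _ assms(2)] by meson
  also have "generate (G Mod ?N) ((\<lambda>a. ?N #> a) ` S) = carrier (G Mod ?N)"
    unfolding h.generate_img[OF S(1)] S(4) surj ..
  also have "L ^ card ((\<lambda>a. ?N #> a) ` S) \<le> L ^ min_generators G"
    using card_image_le[OF S(2), of "\<lambda>a. ?N #> a"] S(3) assms(2) by (intro power_increasing) linarith+
  finally show ?thesis by (simp add: order_def)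
qed

lemma (in comm_group) order_Mod_multiples:
  assumes "finite (carrier G)"
  shows "order (G Mod multiples L G) > 0" "order (G Mod multiples L G) \<le> order G"
proof -
  have *: "order (G Mod multiples L G) * card (multiples L G) = order G"
    using lagrange[OF subgroup_multiples] by (simp add: FactGroup_def order_def)
  have "order G > 0" using assms by (simp add: order_gt_0_iff_finite)
  with * show "order (G Mod multiples L G) > 0"
    by (metis gr0I mult_0)
  show "order (G Mod multiples L G) \<le> order G"
    using * \<open>order G > 0\<close> dvd_imp_le[of "order (G Mod multiples L G)" "order G"] by (metis dvd_triv_left)
qed

text \<open>
  Every element is killed by the order of the group, so Bezout's identity turns a multiple by the
  greatest common divisor into a multiple by \<open>L\<close>.
\<close>

lemma (in comm_group) multiples_gcd_order:
  assumes "finite (carrier G)"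
  shows "multiples (gcd L (order G)) G = multiples L G"
proof
  have ord: "x [^] order G = \<one>" if "x \<in> carrier G" for x
    using that by (rule pow_order_eq_1)
  show "multiples L G \<subseteq> multiples (gcd L (order G)) G"
  proof
    fix a assume "a \<in> multiples L G"
    then obtain x where x: "x \<in> carrier G" "a = x [^] L"
      by (auto simp: multiples_def)
    have q: "L div gcd L (order G) * gcd L (order G) = L"
      by simp
    have "a = (x [^] (L div gcd L (order G))) [^] gcd L (order G)"
      unfolding x(2) nat_pow_pow[OF x(1)] q ..
    moreover have "x [^] (L div gcd L (order G)) \<in> carrier G"
      using x by simp
    ultimately show "a \<in> multiples (gcd L (order G)) G"
      unfolding multiples_def by blast
  qed
  show "multiples (gcd L (order G)) G \<subseteq> multiples L G"
  proof (cases "L = 0")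
    case True
    then show ?thesis using ord by (auto simp: multiples_def)
  next
    case False
    then obtain u v where uv: "L * u = order G * v + gcd L (order G)"
      using bezout_nat[of L "order G"] by auto
    show ?thesis
    proof
      fix a assume "a \<in> multiples (gcd L (order G)) G"
      then obtain x where x: "x \<in> carrier G" "a = x [^] gcd L (order G)"
        by (auto simp: multiples_def)
      have "(x [^] u) [^] L = x [^] (order G * v) \<otimes> x [^] gcd L (order G)"
        unfolding nat_pow_pow[OF x(1)] nat_pow_mult[OF x(1)] uv[symmetric] by (simp only: mult.commute)
      also have "x [^] (order G * v) = \<one>"
        using nat_pow_pow[OF x(1), of "order G" v] ord[OF x(1)] by simp
      finally have "a = (x [^] u) [^] L"
        using x by simp
      moreover have "x [^] u \<in> carrier G"
        using x by simp
      ultimately show "a \<in> multiples L G"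
        unfolding multiples_def by blast
    qed
  qed
qed

lemma (in comm_group) order_Mod_multiples_order:
  assumes "finite (carrier G)"
  shows "order (G Mod multiples (order G) G) = order G"
proof -
  have "multiples (order G) G = {\<one>}"
  proof
    show "multiples (order G) G \<subseteq> {\<one>}"
      using pow_order_eq_1 by (auto simp: multiples_def)
    show "{\<one>} \<subseteq> multiples (order G) G"
      using subgroup.one_closed[OF subgroup_multiples] by simp
  qed
  then show ?thesis
    using lagrange[OF subgroup_multiples, of "order G"] by (simp add: FactGroup_def order_def)
qed

section \<open>Bounds for the entropic time\<close>

text \<open>
  By the intermediate value theorem: the entropy is continuous, vanishes at time \<open>0\<close>, and comes
  arbitrarily close to \<open>ln L\<close> because the law flattens to the uniform one.
\<close>

lemma walk_entropy_surj:
  assumes "L \<ge> 2" "0 \<le> y" "y < ln (real L)"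
  shows "\<exists>s\<ge>0. walk_entropy w L s = y"
proof -
  define \<delta> where "\<delta> = exp (- y) - 1 / real L"
  \<comment> \<open>A time so large that \<open>2 / sqrt S\<close> uses only half of the gap \<open>\<delta>\<close> between \<open>exp (- y)\<close> and \<open>1 / L\<close>.\<close>
  define S where "S = (4 / \<delta>) ^ 2"
  have "exp (- ln (real L)) < exp (- y)"
    using assms by simp
  then have \<delta>: "\<delta> > 0"
    using assms by (simp add: \<delta>_def exp_minus field_simps)
  then have S: "S > 0" "2 / sqrt S = \<delta> / 2"
    by (simp_all add: S_def)
  have "1 / real L + 2 / sqrt S \<le> exp (- y)"
    unfolding S(2) using \<delta> by (simp add: \<delta>_def field_simps)
  moreover have "1 / real L + 2 / sqrt S > 0"
    using S(1) assms by (intro add_pos_pos) auto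
  ultimately have "ln (1 / real L + 2 / sqrt S) \<le> ln (exp (- y))"
    by (rule ln_mono)
  then have "y \<le> walk_entropy w L S"
    using walk_entropy_ge[of L S w] S assms by simp
  moreover have "walk_entropy w L 0 \<le> y"
    using assms by (simp add: walk_entropy_0)
  moreover have "continuous_on {0..S} (walk_entropy w L)"
    by (rule continuous_on_subset[OF continuous_on_walk_entropy]) (use assms in auto)
  ultimately show ?thesis
    using IVT'[of "walk_entropy w L" 0 y S] S by auto
qed

lemma entropic_time_eq:
  assumes "L \<ge> 2" "k > 0" "N > 0" "N < L ^ k"
  obtains s where "s \<ge> 0" "entropic_time w k L N = real k * s" "walk_entropy w L s = ln (real N) / real k"
proof -
  have "ln (real N) < ln (real L ^ k)"
    using assms by (subst ln_less_cancel_iff) (auto simp flip: of_nat_power)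
  then have "ln (real N) / real k < ln (real L)"
    using assms by (simp add: ln_realpow divide_simps mult.commute)
  with assms obtain s where "s \<ge> 0" "walk_entropy w L s = ln (real N) / real k"
    using walk_entropy_surj[of L "ln (real N) / real k" w] by auto
  then have *: "ln (real N) / real k \<in> walk_entropy w L ` {0..}"
    by (intro image_eqI[of _ _ s]) auto
  show ?thesis
    using inv_into_into[OF *] f_inv_into_f[OF *] assms by (intro that) (auto simp: entropic_time_def)
qed

lemma entropic_time_one:
  assumes "L \<ge> 1" "k > 0"
  shows "entropic_time w k L 1 = 0"
proof (cases "L = 1")
  case False
  with assms have L: "L \<ge> 2" by simp
  have "1 < L ^ k"
    using one_less_power[of L k] L assms(2) by linarith
  with L assms obtain s where s: "s \<ge> 0" "entropic_time w k L 1 = real k * s" "walk_entropy w L s = 0"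
    using entropic_time_eq[of L k 1 w] by auto
  have "s = 0"
    using walk_entropy_less[OF L, of 0 s w] walk_entropy_0[of L w] L s by force
  with s show ?thesis by simp
qed (simp add: entropic_time_def)

text \<open>
  On the smaller cycle the entropy is lower at each time, so it reaches a given level later.
\<close>

lemma entropic_time_antimono_dvd:
  assumes "L' \<ge> 2" "L' dvd L" "L > 0" "k > 0" "N > 0" "N < L' ^ k"
  shows "entropic_time w k L N \<le> entropic_time w k L' N"
proof -
  have le: "L' \<le> L" using assms by (intro dvd_imp_le)
  then have "L' ^ k \<le> L ^ k" by (intro power_mono) auto
  with assms(6) have "N < L ^ k" by simp
  moreover have "L \<ge> 2" using assms(1) le by simp
  ultimately obtain s where s: "s \<ge> 0" "entropic_time w k L N = real k * s"
      "walk_entropy w L s = ln (real N) / real k"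
    using assms(4,5) by (elim entropic_time_eq)
  obtain s' where s': "s' \<ge> 0" "entropic_time w k L' N = real k * s'"
      "walk_entropy w L' s' = ln (real N) / real k"
    using assms entropic_time_eq[of L' k N w] by auto
  have "walk_entropy w L s \<le> walk_entropy w L s'"
    using walk_entropy_dvd_le[of L' L w s'] assms s s' by simp
  then have "s \<le> s'"
    using walk_entropy_less[of L s' s w] s'(1) le assms(1) by force
  then show ?thesis
    using s s' by (simp add: mult_left_mono)
qed

text \<open>
  At the time \<open>s\<close> with entropy \<open>h = ln N / k\<close>, flatness of the law gives
  \<open>exp (- h) \<le> 1 / L + 2 / sqrt s\<close>. As \<open>N \<le> L ^ d\<close>, the number \<open>exp h\<close> is at most
  \<open>L powr (1 - \<delta>)\<close>, so \<open>1 / L\<close> is at most \<open>2 powr (- \<delta>)\<close> times the left-hand side. The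
  remaining fraction must come from \<open>2 / sqrt s\<close>, which bounds \<open>s\<close> by a constant times
  \<open>exp (2 h)\<close>, that is, times \<open>N powr (2 / k)\<close>.
\<close>

lemma entropic_time_le:
  assumes "L \<ge> 2" "k > 0" "N > 0" "N \<le> L ^ d" "real d \<le> (1 - \<delta>) * real k" "\<delta> > 0" "N \<le> n"
  shows "entropic_time w k L N \<le> 4 / (1 - 2 powr (- \<delta>)) ^ 2 * (real k * real n powr (2 / real k))"
proof -
  define h where "h = ln (real N) / real k"
  define \<rho> where "\<rho> = 2 powr (- \<delta>)"
  have \<rho>: "\<rho> < 1"
    using assms(6) powr_less_mono[of "- \<delta>" 0 2] by (simp add: \<rho>_def)
  have "real d < real k"
    using assms(5) mult_pos_pos[of \<delta> "real k"] assms(2,6) unfolding left_diff_distrib by linarith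
  then have "L ^ d < L ^ k"
    using assms(1) by simp
  with assms(4) have "N < L ^ k" by simp
  with assms(1-3) obtain s where s: "s \<ge> 0" "entropic_time w k L N = real k * s" "walk_entropy w L s = h"
    unfolding h_def by (rule entropic_time_eq)
  have M: "exp h ^ 2 \<le> real n powr (2 / real k)"
  proof -
    have "exp h ^ 2 = real N powr (2 / real k)"
      using assms(3) by (simp add: h_def powr_def exp_of_nat_mult[symmetric])
    also have "\<dots> \<le> real n powr (2 / real k)"
      using assms by (intro powr_mono2) auto
    finally show ?thesis .
  qed
  have "s \<le> 4 / (1 - \<rho>) ^ 2 * exp h ^ 2"
  proof (cases "s = 0")
    case False
    with s have s0: "s > 0" by simp
    have "ln (real N) \<le> ln (real L ^ d)"
      using assms by (subst ln_le_cancel_iff) (auto simp flip: of_nat_power)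
    also have "\<dots> = real d * ln (real L)"
      using assms by (simp add: ln_realpow)
    also have "\<dots> \<le> (1 - \<delta>) * real k * ln (real L)"
      using assms by (intro mult_right_mono) auto
    finally have "h \<le> (1 - \<delta>) * ln (real L)"
      using assms by (simp add: h_def divide_simps mult_ac)
    moreover have "\<delta> * ln 2 \<le> \<delta> * ln (real L)"
      using assms by (intro mult_left_mono) auto
    ultimately have "h - ln (real L) \<le> - \<delta> * ln 2"
      by (simp add: algebra_simps)
    then have "exp (h - ln (real L)) \<le> \<rho>"
      by (simp add: \<rho>_def powr_def)
    then have ratio: "exp h * (1 / real L) \<le> \<rho>"
      using assms by (simp add: exp_diff)
    have pos: "1 / real L + 2 / sqrt s > 0"
      using assms s0 by (intro add_pos_pos) auto
    have "- h \<le> ln (1 / real L + 2 / sqrt s)"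
      using walk_entropy_ge[of L s w] assms s0 s(3) by simp
    then have "exp (- h) \<le> 1 / real L + 2 / sqrt s"
      using pos by (metis exp_le_cancel_iff exp_ln)
    then have "exp h * exp (- h) \<le> exp h * (1 / real L + 2 / sqrt s)"
      by (intro mult_left_mono) auto
    then have "1 \<le> exp h * (1 / real L) + exp h * (2 / sqrt s)"
      by (simp add: exp_minus distrib_left)
    with ratio have "1 - \<rho> \<le> exp h * (2 / sqrt s)" by linarith
    then have "(1 - \<rho>) * sqrt s \<le> 2 * exp h"
      using s0 by (simp add: field_simps)
    then have "((1 - \<rho>) * sqrt s) ^ 2 \<le> (2 * exp h) ^ 2"
      using \<rho> s0 by (intro power_mono) auto
    then have "(1 - \<rho>) ^ 2 * s \<le> 4 * exp h ^ 2"
      using s0 by (simp add: power_mult_distrib)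
    then show ?thesis
      using \<rho> by (simp add: field_simps)
  qed simp
  also have "\<dots> \<le> 4 / (1 - \<rho>) ^ 2 * real n powr (2 / real k)"
    using M by (intro mult_left_mono) auto
  finally have "real k * s \<le> real k * (4 / (1 - \<rho>) ^ 2 * real n powr (2 / real k))"
    by (intro mult_left_mono) auto
  then show ?thesis
    by (simp add: s(2) \<rho>_def mult_ac)
qed

text \<open>
  Here the entropy level is \<open>h = ln n / k\<close>, and \<open>exp (2 h) = n powr (2 / k)\<close>. At a time \<open>s \<ge> 1\<close>
  the choice \<open>a = 1 / s\<close> bounds \<open>exp h\<close> by a multiple of \<open>sqrt s\<close>. At a time
  \<open>s < 1\<close> the choice \<open>a = 1 / sqrt s\<close> gives \<open>h \<le> 6 s\<^bsup>1/4\<^esup>\<close>. So \<open>h\<close> is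
  bounded, and since \<open>h \<ge> 1 / B\<close> the time \<open>s\<close> is bounded away from \<open>0\<close>. The two terms of
  the minimum come from these two cases.
\<close>

lemma entropic_time_ge:
  assumes "n \<ge> 2" "k \<ge> 2" "real k \<le> B * ln (real n)" "B > 0"
  shows "min (exp (- 4) / 25) (exp (- 12) * (1 / (6 * B)) ^ 4) * (real k * real n powr (2 / real k))
    \<le> entropic_time w k n n"
proof -
  define h where "h = ln (real n) / real k"
  have "n ^ 1 < n ^ k"
    using assms by (intro power_strict_increasing) auto
  with assms obtain s where s: "s \<ge> 0" "entropic_time w k n n = real k * s" "walk_entropy w n s = h"
    unfolding h_def using entropic_time_eq[of n k n w] by auto
  have h: "1 / B \<le> h" "h > 0"
    using assms by (simp_all add: h_def field_simps)
  have "s \<noteq> 0"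
    using s(3) h assms(1) walk_entropy_0[of n w] by auto
  with s have s0: "s > 0" by simp
  have M: "real n powr (2 / real k) = exp h ^ 2"
    using assms by (simp add: h_def powr_def exp_of_nat_mult[symmetric])
  have le: "h \<le> ln (1 + 4 / sqrt a) + 2 * a * s" if "a > 0" for a
    using walk_entropy_le[of n s a w] assms s0 s(3) that by simp
  have "min (exp (- 4) / 25) (exp (- 12) * (1 / (6 * B)) ^ 4) * exp h ^ 2 \<le> s"
  proof (cases "s \<ge> 1")
    case True
    have "h \<le> ln (1 + 4 * sqrt s) + 2"
      using le[of "1 / s"] s0 by (simp add: real_sqrt_divide)
    also have "\<dots> \<le> ln (5 * sqrt s) + 2"
      using True by (intro add_right_mono ln_mono) (auto intro: add_pos_nonneg)
    finally have "exp h \<le> exp (ln (5 * sqrt s) + 2)"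
      by simp
    also have "\<dots> = 5 * sqrt s * exp 2"
      using s0 by (simp add: exp_add)
    finally have "exp h ^ 2 \<le> (5 * sqrt s * exp 2) ^ 2"
      by (intro power_mono) auto
    also have "\<dots> = 25 * s * exp 4"
      using s0 by (simp add: power_mult_distrib exp_of_nat_mult[symmetric])
    finally have "exp (- 4) / 25 * exp h ^ 2 \<le> s"
      by (simp add: exp_minus field_simps)
    moreover have "min (exp (- 4) / 25) (exp (- 12) * (1 / (6 * B)) ^ 4) * exp h ^ 2 \<le> exp (- 4) / 25 * exp h ^ 2"
      by (intro mult_right_mono) auto
    ultimately show ?thesis by linarith
  next
    case False
    define u where "u = sqrt (sqrt s)"
    have u: "u > 0" "u \<le> 1" "sqrt s = u ^ 2"
      using s0 False by (simp_all add: u_def)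
    have "s = sqrt s ^ 2"
      using s0 by simp
    also have "\<dots> = u ^ 4"
      unfolding u(3) by simp
    finally have u4: "s = u ^ 4" .
    have "h \<le> ln (1 + 4 * u) + 2 * u ^ 2"
      using le[of "1 / u ^ 2"] u u4 by (simp add: real_sqrt_divide power4_eq_xxxx power2_eq_square)
    also have "ln (1 + 4 * u) \<le> 4 * u"
      using u by (intro ln_add_one_self_le_self) auto
    also have "u ^ 2 \<le> u"
      using u by (simp add: power2_eq_square mult_left_le)
    finally have hu: "h \<le> 6 * u" by simp
    then have "exp h \<le> exp 6"
      using u by simp
    then have "exp h ^ 2 \<le> exp 6 ^ 2"
      by (intro power_mono) auto
    also have "exp 6 ^ 2 = exp (12::real)"
      by (simp add: exp_of_nat_mult[symmetric])
    finally have e: "exp (- 12) * exp h ^ 2 \<le> 1"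
      by (simp add: exp_minus field_simps)
    have "1 / (6 * B) \<le> u"
    proof -
      have "1 / (6 * B) = 1 / B / 6" by simp
      with hu h(1) show ?thesis by linarith
    qed
    then have "(1 / (6 * B)) ^ 4 \<le> u ^ 4"
      using assms(4) by (intro power_mono) auto
    then have "exp (- 12) * exp h ^ 2 * (1 / (6 * B)) ^ 4 \<le> 1 * s"
      using e u4 assms(4) by (intro mult_mono) auto
    moreover have "min (exp (- 4) / 25) (exp (- 12) * (1 / (6 * B)) ^ 4) * exp h ^ 2
      \<le> exp (- 12) * (1 / (6 * B)) ^ 4 * exp h ^ 2"
      by (intro mult_right_mono) auto
    moreover have "exp (- 12) * (1 / (6 * B)) ^ 4 * exp h ^ 2 = exp (- 12) * exp h ^ 2 * (1 / (6 * B)) ^ 4"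
      by (simp only: mult_ac)
    ultimately show ?thesis by linarith
  qed
  then have "real k * (min (exp (- 4) / 25) (exp (- 12) * (1 / (6 * B)) ^ 4) * exp h ^ 2) \<le> real k * s"
    by (intro mult_left_mono) auto
  then show ?thesis
    by (simp only: s(2) M mult_ac)
qed

section \<open>The order of the maximal entropic time\<close>

text \<open>
  Replacing \<open>L\<close> by its greatest common divisor with the order of the group keeps the quotient
  and passes to a smaller cycle, so it can only increase the entropic time. This is what makes the
  maximum over all \<open>L\<close> a maximum over finitely many.
\<close>

lemma (in comm_group) entropic_time_gcd_order:
  fixes L :: nat
  assumes "finite (carrier G)" "min_generators G < k" "L \<ge> 1"
  shows "entropic_time w k L (order (G Mod multiples L G))
    \<le> entropic_time w k (gcd L (order G)) (order (G Mod multiples (gcd L (order G)) G))"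
proof -
  define g where "g = gcd L (order G)"
  define N where "N = order (G Mod multiples L G)"
  have g: "g \<ge> 1" "g dvd L"
    using assms by (auto simp: g_def Suc_le_eq)
  have N_g: "order (G Mod multiples g G) = N"
    unfolding g_def N_def multiples_gcd_order[OF assms(1)] ..
  have N_pos: "N > 0"
    unfolding N_def using assms(1) by (rule order_Mod_multiples)
  have N_le: "N \<le> g ^ min_generators G"
    unfolding N_g[symmetric] using assms(1) g by (intro order_Mod_multiples_le_power) auto
  have "entropic_time w k L N \<le> entropic_time w k g N"
  proof (cases "g = 1")
    case True
    with N_pos N_le have "N = 1" by simp
    then show ?thesis
      using assms g by (simp add: entropic_time_one del: One_nat_def)
  next
    case False
    with g have g2: "g \<ge> 2" by simp
    then have "g ^ min_generators G < g ^ k"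
      using assms(2) by simp
    with N_le have "N < g ^ k" by simp
    then show ?thesis
      using assms g g2 N_pos by (intro entropic_time_antimono_dvd) auto
  qed
  then show ?thesis
    unfolding g_def[symmetric] N_g N_def[symmetric] .
qed

theorem propositionB:
  fixes w :: walk and d n k :: "nat \<Rightarrow> nat"
  assumes "filterlim n at_top sequentially"
    and "(\<lambda>j. 1 :: real) \<in> o(\<lambda>j. real (k j))"
    and "(\<lambda>j. real (k j)) \<in> O(\<lambda>j. ln (real (n j)))"
    and "(\<lambda>j. real (k j) - real (d j)) \<in> \<Theta>(\<lambda>j. real (k j))"
    and "\<forall>\<^sub>F j in sequentially. d j \<le> k j"
  shows "\<exists>c > 0. \<exists>C > 0. \<forall>\<^sub>F j in sequentially. \<forall>G :: 'a monoid.
    comm_group G \<and> finite (carrier G) \<and> order G = n j \<and> min_generators G = d j \<longrightarrow>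
    (\<exists>L. is_arg_max (\<lambda>L. entropic_time w (k j) L (order (G Mod multiples L G))) (\<lambda>L. L \<ge> 1) L \<and>
      c * (real (k j) * real (order G) powr (2 / real (k j)))
        \<le> entropic_time w (k j) L (order (G Mod multiples L G)) \<and>
      entropic_time w (k j) L (order (G Mod multiples L G))
        \<le> C * (real (k j) * real (order G) powr (2 / real (k j))))"
proof -
  obtain B where B: "B > 0" "\<forall>\<^sub>F j in sequentially. norm (real (k j)) \<le> B * norm (ln (real (n j)))"
    using landau_o.bigE[OF assms(3)] .
  obtain \<delta> where \<delta>: "\<delta> > 0"
      "\<forall>\<^sub>F j in sequentially. norm (real (k j) - real (d j)) \<ge> \<delta> * norm (real (k j))"
    using landau_omega.bigE[OF bigthetaD2[OF assms(4)]] .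
  have k2: "\<forall>\<^sub>F j in sequentially. norm (1 :: real) \<le> 1 / 2 * norm (real (k j))"
    using landau_o.smallD[OF assms(2), of "1/2"] by simp
  have n2: "\<forall>\<^sub>F j in sequentially. n j \<ge> 2"
    using assms(1) by (simp add: filterlim_at_top)
  define c where "c = min (exp (- 4) / 25) (exp (- 12) * (1 / (6 * B)) ^ 4)"
  define C where "C = 4 / (1 - 2 powr (- \<delta>)) ^ 2"
  have "c > 0"
    using B by (simp add: c_def)
  moreover have "2 powr (- \<delta>) < 1"
    using \<delta>(1) powr_less_mono[of "- \<delta>" 0 2] by simp
  then have "C > 0"
    by (auto simp: C_def)
  moreover have "\<forall>\<^sub>F j in sequentially. \<forall>G :: 'a monoid.
    comm_group G \<and> finite (carrier G) \<and> order G = n j \<and> min_generators G = d j \<longrightarrow>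
    (\<exists>L. is_arg_max (\<lambda>L. entropic_time w (k j) L (order (G Mod multiples L G))) (\<lambda>L. L \<ge> 1) L \<and>
      c * (real (k j) * real (order G) powr (2 / real (k j)))
        \<le> entropic_time w (k j) L (order (G Mod multiples L G)) \<and>
      entropic_time w (k j) L (order (G Mod multiples L G))
        \<le> C * (real (k j) * real (order G) powr (2 / real (k j))))"
    using B(2) \<delta>(2) k2 n2 assms(5)
  proof eventually_elim
    case (elim j)
    have k: "k j \<ge> 2" "real (k j) \<le> B * ln (real (n j))"
      using elim by auto
    have d: "real (d j) \<le> (1 - \<delta>) * real (k j)"
      using elim by (simp add: algebra_simps)
    have "\<delta> * real (k j) > 0"
      using \<delta>(1) k(1) by simp
    with d have dk: "d j < k j"
      by (simp add: algebra_simps)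
    show ?case
    proof (intro allI impI)
      fix G :: "'a monoid"
      assume asm: "comm_group G \<and> finite (carrier G) \<and> order G = n j \<and> min_generators G = d j"
      then interpret comm_group G by blast
      note G = asm[THEN conjunct2, THEN conjunct1] asm[THEN conjunct2, THEN conjunct2]
      define f where "f L = entropic_time w (k j) L (order (G Mod multiples L G))" for L
      have "Max (f ` {1..n j}) \<in> f ` {1..n j}"
        using elim(4) by (intro Max_in) auto
      then obtain L0 where L0: "L0 \<in> {1..n j}" "f L0 = Max (f ` {1..n j})"
        by force
      have max: "f L \<le> f L0" if "L \<ge> 1" for L
      proof -
        have "gcd L (n j) \<le> n j" "gcd L (n j) \<ge> 1"
          using elim(4) that by (auto intro: gcd_le2_nat simp: Suc_le_eq)
        then have "f (gcd L (n j)) \<le> f L0"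
          unfolding L0(2) by (intro Max_ge) auto
        moreover have "f L \<le> f (gcd L (n j))"
          unfolding f_def using entropic_time_gcd_order[of "k j" L w] G dk that by simp
        ultimately show ?thesis by linarith
      qed
      have lower: "c * (real (k j) * real (order G) powr (2 / real (k j))) \<le> f L0"
      proof -
        have "c * (real (k j) * real (n j) powr (2 / real (k j))) \<le> f (n j)"
          unfolding c_def f_def using order_Mod_multiples_order[OF G(1)] G(2) entropic_time_ge[OF elim(4) k B(1)]
          by simp
        also have "\<dots> \<le> f L0"
          using elim(4) by (intro max) simp
        finally show ?thesis using G(2) by simp
      qed
      have upper: "f L0 \<le> C * (real (k j) * real (order G) powr (2 / real (k j)))"
      proof (cases "L0 = 1")
        case True
        then have "f L0 = 0"
          by (simp add: f_def entropic_time_def)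
        then show ?thesis
          using \<open>C > 0\<close> by simp
      next
        case False
        with L0 have L2: "L0 \<ge> 2" by simp
        show ?thesis
          unfolding f_def C_def
        proof (rule entropic_time_le[where d = "d j"])
          show "order (G Mod multiples L0 G) \<le> L0 ^ d j"
            using order_Mod_multiples_le_power[OF G(1), of L0] G(2) L2 by simp
        qed (use L2 k(1) d \<delta>(1) order_Mod_multiples[OF G(1)] in auto)
      qed
      have "is_arg_max f (\<lambda>L. L \<ge> 1) L0"
        using L0(1) max by (auto simp: is_arg_max_def not_less)
      with lower upper show "\<exists>L. is_arg_max (\<lambda>L. entropic_time w (k j) L (order (G Mod multiples L G))) (\<lambda>L. L \<ge> 1) L \<and>
          c * (real (k j) * real (order G) powr (2 / real (k j)))
            \<le> entropic_time w (k j) L (order (G Mod multiples L G)) \<and>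
          entropic_time w (k j) L (order (G Mod multiples L G))
            \<le> C * (real (k j) * real (order G) powr (2 / real (k j)))"
        unfolding f_def by blast
    qed
  qed
  ultimately show ?thesis by blast
qed

end
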